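(* Let $\Omega=\{x\in\mathbb{R}^4:\ |x|\le \exp(-2)\}$ and consider the map $u=(u_1,u_2):\Omega\to\mathbb{S}^1\subset\mathbb{R}^2$ defined (for $x\neq 0$) by $$u_1(x)=\sin\big(\log(\log|x|^{-1})\big),\qquad u_2(x)=\cos\big(\log(\log|x|^{-1})\big).$$ Then $u$ lies in $W^{2,2}(\Omega)\cap L^\infty(\Omega)$ but is not continuous at the point $x=0$, and $u$ is a $W^{2,2}$-weak solution of the system $$\Delta^2u_1=\left(R_1^2+R_2^2\right)\frac{2(u_1+u_2)}{1+|u|^2}-\frac{20u_1}{1+|u|^2}|\nabla u|^4,$$ $$\Delta^2u_2=\left(R_1^2+R_2^2\right)\frac{2(u_2-u_1)}{1+|u|^2}-\frac{20u_2}{1+|u|^2}|\nabla u|^4,$$ where $$R_1=\Delta u_1+\frac{2(u_1+u_2)}{1+|u|^2}|\nabla u|^2,\qquad R_2=\Delta u_2+\frac{2(u_2-u_1)}{1+|u|^2}|\nabla u|^2 .$$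
   Context: $|\nabla u|^2=|\nabla u_1|^2+|\nabla u_2|^2$ and $|u|^2=u_1^2+u_2^2$. A $W^{2,2}$-weak solution of $\Delta^2u=F$, with $F$ the (integrable) right-hand side of the system, means $u\in W^{2,2}(\Omega,\mathbb{R}^2)$ and $\int_\Omega\Delta u\cdot\Delta\varphi\,dx=\int_\Omega F\cdot\varphi\,dx$ for every smooth $\varphi$ with values in $\mathbb{R}^2$ and compact support in the interior of $\Omega$. Not continuous at $x=0$ means that $u$ cannot be (re)defined at $0$ so as to be continuous there. *)

theory Defs
  imports "HOL-Analysis.Analysis"
begin

section \<open>Smooth functions and test functions\<close>

definition partial_deriv :: "'n::finite \<Rightarrow> (real^'n \<Rightarrow> 'b::real_normed_vector) \<Rightarrow> real^'n \<Rightarrow> 'b" where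
  "partial_deriv i f x = frechet_derivative f (at x) (axis i 1)"

definition laplacian :: "(real^'n::finite \<Rightarrow> 'b::real_normed_vector) \<Rightarrow> real^'n \<Rightarrow> 'b" where
  "laplacian f x = (\<Sum>i\<in>UNIV. partial_deriv i (partial_deriv i f) x)"

fun C_k :: "nat \<Rightarrow> (real^'n::finite \<Rightarrow> 'b::real_normed_vector) \<Rightarrow> bool" where
  "C_k 0 f \<longleftrightarrow> continuous_on UNIV f"
| "C_k (Suc k) f \<longleftrightarrow> (\<forall>x. f differentiable (at x)) \<and> (\<forall>i. C_k k (partial_deriv i f))"

definition smooth :: "(real^'n::finite \<Rightarrow> 'b::real_normed_vector) \<Rightarrow> bool" where
  "smooth f \<longleftrightarrow> (\<forall>k. C_k k f)"

text \<open>Test functions on \<open>\<Omega>\<close> are smooth with compact support in the interior of \<open>\<Omega>\<close>; they are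
  represented by their extension by zero to the whole space.\<close>

definition test_function :: "(real^'n::finite) set \<Rightarrow> (real^'n \<Rightarrow> 'b::real_normed_vector) \<Rightarrow> bool" where
  "test_function \<Omega> \<phi> \<longleftrightarrow> smooth \<phi> \<and> compact (closure {x. \<phi> x \<noteq> 0}) \<and>
     closure {x. \<phi> x \<noteq> 0} \<subseteq> interior \<Omega>"

section \<open>Lebesgue and Sobolev spaces\<close>

definition L2_on :: "(real^'n::finite) set \<Rightarrow> (real^'n \<Rightarrow> 'b::euclidean_space) \<Rightarrow> bool" where
  "L2_on \<Omega> f \<longleftrightarrow> f \<in> borel_measurable (lebesgue_on \<Omega>) \<and>
     integrable (lebesgue_on \<Omega>) (\<lambda>x. (norm (f x))\<^sup>2)"

definition Linf_on :: "(real^'n::finite) set \<Rightarrow> (real^'n \<Rightarrow> 'b::euclidean_space) \<Rightarrow> bool" where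
  "Linf_on \<Omega> f \<longleftrightarrow> f \<in> borel_measurable (lebesgue_on \<Omega>) \<and>
     (\<exists>C. AE x in lebesgue_on \<Omega>. norm (f x) \<le> C)"

definition L1_loc :: "(real^'n::finite) set \<Rightarrow> (real^'n \<Rightarrow> 'b::euclidean_space) \<Rightarrow> bool" where
  "L1_loc \<Omega> f \<longleftrightarrow> (\<forall>K. compact K \<and> K \<subseteq> interior \<Omega> \<longrightarrow> f absolutely_integrable_on K)"

text \<open>\<open>g\<close> is a version of the weak partial derivative of \<open>f\<close> in direction \<open>i\<close>; versions
  agree almost everywhere on the interior of \<open>\<Omega>\<close>.\<close>

definition weak_partial ::
  "(real^'n::finite) set \<Rightarrow> 'n \<Rightarrow> (real^'n \<Rightarrow> 'b::euclidean_space) \<Rightarrow> (real^'n \<Rightarrow> 'b) \<Rightarrow> bool" where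
  "weak_partial \<Omega> i f g \<longleftrightarrow> L1_loc \<Omega> f \<and> L1_loc \<Omega> g \<and>
     (\<forall>\<phi> :: real^'n \<Rightarrow> real. test_function \<Omega> \<phi> \<longrightarrow>
        integral\<^sup>L (lebesgue_on \<Omega>) (\<lambda>x. partial_deriv i \<phi> x *\<^sub>R f x) =
        - integral\<^sup>L (lebesgue_on \<Omega>) (\<lambda>x. \<phi> x *\<^sub>R g x))"

text \<open>\<open>u\<close> is in \<open>W\<^sup>2\<^sup>,\<^sup>2(\<Omega>)\<close>, with weak derivatives \<open>\<partial>\<^sub>i u = Du i\<close> and
  \<open>\<partial>\<^sub>j \<partial>\<^sub>i u = D2u i j\<close>.\<close>

definition W22_derivs ::
  "(real^'n::finite) set \<Rightarrow> (real^'n \<Rightarrow> 'b::euclidean_space) \<Rightarrow>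
   ('n \<Rightarrow> real^'n \<Rightarrow> 'b) \<Rightarrow> ('n \<Rightarrow> 'n \<Rightarrow> real^'n \<Rightarrow> 'b) \<Rightarrow> bool" where
  "W22_derivs \<Omega> u Du D2u \<longleftrightarrow> L2_on \<Omega> u \<and>
     (\<forall>i. L2_on \<Omega> (Du i) \<and> weak_partial \<Omega> i u (Du i)) \<and>
     (\<forall>i j. L2_on \<Omega> (D2u i j) \<and> weak_partial \<Omega> j (Du i) (D2u i j))"

definition W22 :: "(real^'n::finite) set \<Rightarrow> (real^'n \<Rightarrow> 'b::euclidean_space) \<Rightarrow> bool" where
  "W22 \<Omega> u \<longleftrightarrow> (\<exists>Du D2u. W22_derivs \<Omega> u Du D2u)"

section \<open>Weak solutions of the fourth-order system\<close>

text \<open>A right-hand side is a function \<open>\<F>\<close> of the pointwise values of \<open>u\<close>, of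
  \<open>|\<nabla>u|\<^sup>2 = \<Sum>\<^sub>i |\<partial>\<^sub>i u|\<^sup>2\<close> and of \<open>\<Delta>u\<close>, the derivatives of \<open>u\<close> being weak ones. As these are
  determined up to null sets, the choice of \<open>Du\<close> and \<open>D2u\<close> is immaterial.\<close>

definition W22_weak_solution ::
  "(real^'n::finite) set \<Rightarrow> ('b::euclidean_space \<Rightarrow> real \<Rightarrow> 'b \<Rightarrow> 'b) \<Rightarrow> (real^'n \<Rightarrow> 'b) \<Rightarrow> bool" where
  "W22_weak_solution \<Omega> \<F> u \<longleftrightarrow> (\<exists>Du D2u. W22_derivs \<Omega> u Du D2u \<and>
     (let lap_u = (\<lambda>x. \<Sum>i\<in>UNIV. D2u i i x);
          grad_u_sq = (\<lambda>x. \<Sum>i\<in>UNIV. (norm (Du i x))\<^sup>2);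
          F = (\<lambda>x. \<F> (u x) (grad_u_sq x) (lap_u x))
      in integrable (lebesgue_on \<Omega>) F \<and>
         (\<forall>\<phi> :: real^'n \<Rightarrow> 'b. test_function \<Omega> \<phi> \<longrightarrow>
            integral\<^sup>L (lebesgue_on \<Omega>) (\<lambda>x. lap_u x \<bullet> laplacian \<phi> x) =
            integral\<^sup>L (lebesgue_on \<Omega>) (\<lambda>x. F x \<bullet> \<phi> x))))"

text \<open>In the following, \<open>u\<close>, \<open>e\<close>, \<open>l\<close> are the values of \<open>u\<close>, \<open>|\<nabla>u|\<^sup>2\<close>, \<open>\<Delta>u\<close> at a point;
  thus \<open>e\<^sup>2\<close> is \<open>|\<nabla>u|\<^sup>4\<close>.\<close>

definition R1 :: "real^2 \<Rightarrow> real \<Rightarrow> real^2 \<Rightarrow> real" where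
  "R1 u e l = l$1 + 2 * (u$1 + u$2) / (1 + (norm u)\<^sup>2) * e"

definition R2 :: "real^2 \<Rightarrow> real \<Rightarrow> real^2 \<Rightarrow> real" where
  "R2 u e l = l$2 + 2 * (u$2 - u$1) / (1 + (norm u)\<^sup>2) * e"

definition system_rhs :: "real^2 \<Rightarrow> real \<Rightarrow> real^2 \<Rightarrow> real^2" where
  "system_rhs u e l = vector
     [((R1 u e l)\<^sup>2 + (R2 u e l)\<^sup>2) * (2 * (u$1 + u$2) / (1 + (norm u)\<^sup>2))
        - 20 * u$1 / (1 + (norm u)\<^sup>2) * e\<^sup>2,
      ((R1 u e l)\<^sup>2 + (R2 u e l)\<^sup>2) * (2 * (u$2 - u$1) / (1 + (norm u)\<^sup>2))
        - 20 * u$2 / (1 + (norm u)\<^sup>2) * e\<^sup>2]"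

end

theory Submission
  imports Defs
begin

text \<open>Write \<open>r = |x|\<close>, \<open>L = - ln r\<close>. Read as a complex number with the components in reverse
  order, the map is \<open>u = e\<^bsup>i ln L\<^esup> = L\<^bsup>i\<^esup>\<close>, a complex power of the logarithm. It has modulus 1,
  and its phase \<open>ln L\<close> tends to infinity at the origin, so it oscillates and has no limit there
  (\<open>no_limit_at_0\<close>).

  Away from 0 the equation is a computation. In the variable \<open>s = ln r\<close> the Laplacian of a
  radial function \<open>F (s)\<close> on \<open>\<real>\<^sup>4\<close> is \<open>r\<^bsup>-2\<^esup> (F'' + 2 F')\<close> and, with \<open>D = d/ds\<close>, the bilaplacian
  is \<open>r\<^bsup>-4\<^esup> (D\<^sup>4 F - 4 D\<^sup>2 F)\<close>. Differentiation in \<open>s\<close> takes \<open>c L\<^bsup>i-k\<^esup>\<close> to \<open>c (k - i) L\<^bsup>i-k-1\<^esup>\<close>,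
  so that \<open>\<Delta>\<^sup>2u = r\<^bsup>-4\<^esup> (4 (1 + i) L\<^bsup>-2\<^esup> - 10 L\<^bsup>-4\<^esup>) u\<close>. On the other side of the system
  \<open>|\<nabla>u|\<^sup>2 = 1 / (r\<^sup>2 L\<^sup>2)\<close> and \<open>R\<^sub>1\<^sup>2 + R\<^sub>2\<^sup>2 = 4 / (r\<^sup>4 L\<^sup>2)\<close>, and the two sides agree
  (\<open>lap_lap_profile_eq\<close>, \<open>system_rhs_wave\<close>).

  What remains is that the origin carries no mass: the classical derivatives off 0 are the weak
  derivatives on the whole ball, and the weak form of the equation has no singular part. Here
  the logarithm is decisive. The derivatives of \<open>u\<close> up to order two are \<open>O(1 / (r\<^sup>2 L))\<close>, hence
  square integrable because \<open>1 / (r\<^sup>4 L\<^sup>2)\<close> is integrable near 0 in dimension four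
  (\<open>integrable_log_weight\<close>); the right-hand side is \<open>O(1 / (r\<^sup>4 L\<^sup>2))\<close>, hence integrable; and
  \<open>\<nabla>\<Delta>u\<close> is \<open>O(1 / (r\<^sup>3 L)) = o(r\<^bsup>-3\<^esup>)\<close>, hence has vanishing flux through small spheres. Without
  the factor \<open>1 / L\<close> the flux would stay of order 1 and could produce a Dirac mass at 0. The
  general form of this argument is \<open>integration_by_parts_punctured\<close>: integration by parts is
  valid across 0 for a vector field that is \<open>o(r\<^bsup>1-n\<^esup>)\<close> and integrable together with its
  divergence.\<close>

section \<open>Partial derivatives and compact supports\<close>

lemma partial_deriv_eq:
  assumes "(f has_derivative f') (at x)"
  shows "partial_deriv i f x = f' (axis i 1)"
  using frechet_derivative_at[OF assms] by (simp add: partial_deriv_def)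

lemma partial_deriv_cong_open:
  assumes "open U" "x \<in> U" "\<And>y. y \<in> U \<Longrightarrow> f y = g y"
  shows "partial_deriv i f x = partial_deriv i g x"
proof -
  have "(f has_derivative f') (at x) \<longleftrightarrow> (g has_derivative f') (at x)" for f'
    using has_derivative_transform_within_open[OF _ assms(1,2)] assms(3) by metis
  then show ?thesis
    by (simp add: partial_deriv_def frechet_derivative_def)
qed

lemma partial_deriv_const [simp]: "partial_deriv i (\<lambda>x. c) x = 0"
  by (rule partial_deriv_eq) (rule has_derivative_const)

lemma partial_deriv_eq_0_outside:
  assumes "closed K" "\<And>x. x \<notin> K \<Longrightarrow> f x = 0" "x \<notin> K"
  shows "partial_deriv i f x = 0"
  using partial_deriv_cong_open[of "- K" x f "\<lambda>_. 0" i] assms by (simp add: open_Compl)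

lemma C1_has_derivative:
  assumes "C_k (Suc 0) f"
  shows "(f has_derivative frechet_derivative f (at x)) (at x)"
  using assms by (simp add: frechet_derivative_works[symmetric])

lemma continuous_on_C1: "C_k (Suc 0) f \<Longrightarrow> continuous_on UNIV f"
  by (auto intro!: differentiable_imp_continuous_on simp: differentiable_on_def)

lemma integrable_lborel_compact_support:
  fixes f :: "'a::euclidean_space \<Rightarrow> 'b::euclidean_space"
  assumes "continuous_on UNIV f" "compact K" "\<And>x. x \<notin> K \<Longrightarrow> f x = 0"
  shows "integrable lborel f"
proof -
  have "integrable lborel (\<lambda>x. indicator K x *\<^sub>R f x)"
    using assms by (intro borel_integrable_compact) (auto intro: continuous_on_subset)
  moreover have "(\<lambda>x. indicator K x *\<^sub>R f x) = f"
    using assms(3) by (auto simp: indicator_def fun_eq_iff)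
  ultimately show ?thesis by simp
qed

lemma bounded_compact_support:
  fixes f :: "'a::topological_space \<Rightarrow> 'b::real_normed_vector"
  assumes "continuous_on K f" "compact K" "\<And>x. x \<notin> K \<Longrightarrow> f x = 0"
  obtains B where "B > 0" "\<And>x. norm (f x) \<le> B"
proof -
  have "bounded (f ` K)"
    using assms by (intro compact_imp_bounded compact_continuous_image)
  then obtain B where "B > 0" "\<And>x. x \<in> K \<Longrightarrow> norm (f x) \<le> B"
    by (auto simp: bounded_pos)
  then show thesis
    using assms(3) by (intro that[of B]) (metis less_imp_le norm_zero)+
qed

text \<open>By translation invariance of Lebesgue measure every difference quotient of \<open>f\<close> integrates
  to 0. The quotients converge to the partial derivative, and the mean value inequality together
  with the compact support dominates them.\<close>

lemma integral_partial_deriv_eq_0: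
  fixes f :: "real^'n::finite \<Rightarrow> 'b::euclidean_space"
  assumes diff: "\<And>x. f differentiable (at x)" and cont: "continuous_on UNIV (partial_deriv i f)"
    and K: "compact K" and supp: "\<And>x. x \<notin> K \<Longrightarrow> f x = 0"
  shows "integral\<^sup>L lborel (partial_deriv i f) = 0"
proof -
  define e :: "real^'n" where "e = axis i 1"
  define h where "h n = inverse (real (Suc n))" for n
  define q where "q n x = (f (x + h n *\<^sub>R e) - f x) /\<^sub>R h n" for n x
  have h: "h n > 0" "h n \<le> 1" for n
    by (auto simp: h_def inverse_le_1_iff)
  have h0: "h \<longlonglongrightarrow> 0"
    unfolding h_def by (rule LIMSEQ_inverse_real_of_nat)
  have e: "norm e = 1"
    by (simp add: e_def norm_axis_1)
  have deriv: "(f has_derivative frechet_derivative f (at x)) (at x)" for x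
    using diff by (simp add: frechet_derivative_works[symmetric])
  have contf: "continuous_on UNIV f"
    using diff by (auto intro!: differentiable_imp_continuous_on simp: differentiable_on_def)
  have [measurable]: "f \<in> borel_measurable borel" "partial_deriv i f \<in> borel_measurable borel"
    using cont contf by (auto intro: borel_measurable_continuous_onI)
  have intf: "integrable lborel f"
    using contf K supp by (rule integrable_lborel_compact_support)
  have pd0: "partial_deriv i f x = 0" if "x \<notin> K" for x
    using partial_deriv_eq_0_outside[OF compact_imp_closed[OF K] supp that] .
  obtain B where B: "B > 0" "\<And>x. norm (partial_deriv i f x) \<le> B"
    using bounded_compact_support[OF continuous_on_subset[OF cont subset_UNIV] K pd0] by blast
  obtain R where R: "\<And>x. x \<in> K \<Longrightarrow> norm x \<le> R"
    using compact_imp_bounded[OF K] by (auto simp: bounded_iff)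
  have trans: "integrable lborel (\<lambda>x. f (x + c))" "integral\<^sup>L lborel (\<lambda>x. f (x + c)) = integral\<^sup>L lborel f" for c
  proof -
    have d: "integral\<^sup>L (distr lborel borel ((+) c)) f = integral\<^sup>L lborel (\<lambda>x. f (c + x))"
      by (rule integral_distr) simp_all
    have d': "integrable (distr lborel borel ((+) c)) f \<longleftrightarrow> integrable lborel (\<lambda>x. f (c + x))"
      by (rule integrable_distr_eq) simp_all
    show "integrable lborel (\<lambda>x. f (x + c))" "integral\<^sup>L lborel (\<lambda>x. f (x + c)) = integral\<^sup>L lborel f"
      using d d' intf by (simp_all add: lborel_distr_plus add.commute)
  qed
  have q_int: "integral\<^sup>L lborel (q n) = 0" for n
    unfolding q_def using trans intf by simp
  have deriv_line: "((\<lambda>t. f (x + t *\<^sub>R e)) has_derivative (\<lambda>s. s *\<^sub>R partial_deriv i f (x + t *\<^sub>R e))) (at t within S)"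
    for x t S
  proof -
    have l: "linear (frechet_derivative f (at (x + t *\<^sub>R e)))"
      using deriv has_derivative_linear by blast
    have "((\<lambda>t. f (x + t *\<^sub>R e)) has_derivative (\<lambda>s. frechet_derivative f (at (x + t *\<^sub>R e)) (s *\<^sub>R e))) (at t within S)"
      by (rule has_derivative_compose[OF _ deriv]) (auto intro!: derivative_eq_intros)
    then show ?thesis
      unfolding linear_scale[OF l] by (simp add: partial_deriv_def e_def)
  qed
  have lip: "norm (q n x) \<le> B" for n x
  proof -
    have "norm (f (x + h n *\<^sub>R e) - f (x + 0 *\<^sub>R e)) \<le> B * norm (h n - 0)"
    proof (rule differentiable_bound[where S = UNIV and f = "\<lambda>t. f (x + t *\<^sub>R e)"])
      show "onorm (\<lambda>s. s *\<^sub>R partial_deriv i f (x + t *\<^sub>R e)) \<le> B" for t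
        using B(2)[of "x + t *\<^sub>R e"] by (intro onorm_le) (auto simp: mult.commute[of B] mult_left_mono)
    qed (use deriv_line in auto)
    then show ?thesis
      using h(1)[of n] by (simp add: q_def divide_simps mult.commute)
  qed
  have q0: "q n x = 0" if "x \<notin> cball 0 (R + 1)" for n x
  proof -
    have "norm x \<le> norm (x + h n *\<^sub>R e) + norm (h n *\<^sub>R e)"
      using norm_triangle_ineq4[of "x + h n *\<^sub>R e" "h n *\<^sub>R e"] by simp
    then have "norm (x + h n *\<^sub>R e) > R" "norm x > R"
      using that h[of n] e by auto
    then show ?thesis
      unfolding q_def using supp R by (metis diff_self leD scaleR_zero_right)
  qed
  have "(\<lambda>n. integral\<^sup>L lborel (q n)) \<longlonglongrightarrow> integral\<^sup>L lborel (partial_deriv i f)"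
  proof (rule integral_dominated_convergence[where w = "\<lambda>x. indicator (cball 0 (R + 1)) x * B"])
    show "integrable lborel (\<lambda>x::real^'n. indicator (cball 0 (R + 1)) x * B)"
      by (intro integrable_mult_left integrable_real_indicator)
        (use emeasure_lborel_cball_finite[of "0::real^'n" "R + 1"] in auto)
    show "AE x in lborel. (\<lambda>n. q n x) \<longlonglongrightarrow> partial_deriv i f x"
    proof (rule AE_I2)
      fix x
      have "((\<lambda>t. f (x + t *\<^sub>R e)) has_vector_derivative partial_deriv i f x) (at 0)"
        using deriv_line[of x 0 UNIV] by (simp add: has_vector_derivative_def)
      then have "((\<lambda>t. norm (f (x + t *\<^sub>R e) - f x - t *\<^sub>R partial_deriv i f x) / norm t) \<longlongrightarrow> 0) (at 0)"
        by (simp add: has_vector_derivative_def has_derivative_iff_norm)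
      moreover have "filterlim h (at 0) sequentially"
        using h0 h by (auto simp: filterlim_at intro!: eventuallyI) (metis less_irrefl)
      ultimately have "(\<lambda>n. norm (f (x + h n *\<^sub>R e) - f x - h n *\<^sub>R partial_deriv i f x) / norm (h n)) \<longlonglongrightarrow> 0"
        by (rule filterlim_compose)
      moreover have "norm (f (x + h n *\<^sub>R e) - f x - h n *\<^sub>R partial_deriv i f x) / norm (h n)
          = norm (q n x - partial_deriv i f x)" for n
      proof -
        have "f (x + h n *\<^sub>R e) - f x - h n *\<^sub>R partial_deriv i f x = h n *\<^sub>R (q n x - partial_deriv i f x)"
          using h(1)[of n] by (simp add: q_def scaleR_diff_right)
        then show ?thesis using h(1)[of n] by simp
      qed
      ultimately show "(\<lambda>n. q n x) \<longlonglongrightarrow> partial_deriv i f x"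
        by (simp add: tendsto_norm_zero_iff Lim_null[of "\<lambda>n. q n x"])
    qed
    show "AE x in lborel. norm (q n x) \<le> indicator (cball 0 (R + 1)) x * B" for n
      using lip q0 B(1) by (intro AE_I2) (auto simp: indicator_def)
  qed (auto simp: q_def[abs_def])
  then show ?thesis
    using q_int by (simp add: LIMSEQ_const_iff)
qed

section \<open>Integration by parts with compact support\<close>

text \<open>A function that is continuous on an open set and vanishes off a closed subset of it is
  continuous everywhere, whatever values it was given outside the open set. This is how products
  of a test function with a function that is singular at a point are handled.\<close>

lemma continuous_on_cutoff:
  fixes f :: "'a::topological_space \<Rightarrow> 'b::real_normed_vector"
  assumes "continuous_on S f" "open S" "closed K" "K \<subseteq> S" "\<And>x. x \<notin> K \<Longrightarrow> f x = 0"
  shows "continuous_on UNIV f"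
proof -
  have "continuous_on (- K) f"
    using assms(5) by (subst continuous_on_cong[OF refl, where g = "\<lambda>_. 0"]) auto
  then have "continuous_on (S \<union> - K) f"
    using assms by (intro continuous_on_open_Un) (auto simp: open_Compl)
  moreover have "S \<union> - K = UNIV" using assms(4) by auto
  ultimately show ?thesis by simp
qed

text \<open>The product rule for \<open>\<psi> \<bullet>\<bullet> V\<close>, integrated. The product is an arbitrary bounded bilinear
  map, because weak derivatives pair scalar test functions with vectors by scaling, while the
  weak form of the system pairs vectors by the inner product.\<close>

lemma integration_by_parts_compact_support:
  fixes prod :: "'a::euclidean_space \<Rightarrow> 'b::euclidean_space \<Rightarrow> 'c::euclidean_space" (infixl \<open>\<bullet>\<bullet>\<close> 70)
    and \<psi> :: "real^'n::finite \<Rightarrow> 'a"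
  assumes bil: "bounded_bilinear prod"
    and \<psi>: "C_k (Suc 0) \<psi>" and K: "compact K" "K \<subseteq> S" and S: "open S"
    and supp: "\<And>x. x \<notin> K \<Longrightarrow> \<psi> x = 0"
    and V: "\<And>x. x \<in> S \<Longrightarrow> V differentiable (at x)"
    and V': "continuous_on S (partial_deriv i V)"
  shows "integrable lborel (\<lambda>x. partial_deriv i \<psi> x \<bullet>\<bullet> V x + \<psi> x \<bullet>\<bullet> partial_deriv i V x)"
    and "integral\<^sup>L lborel (\<lambda>x. partial_deriv i \<psi> x \<bullet>\<bullet> V x + \<psi> x \<bullet>\<bullet> partial_deriv i V x) = 0"
proof -
  interpret bounded_bilinear prod by (rule bil)
  have clK: "closed K" using K(1) by (rule compact_imp_closed)
  have pd0: "partial_deriv j \<psi> x = 0" if "x \<notin> K" for x j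
    using partial_deriv_eq_0_outside[OF clK supp that] .
  have contV: "continuous_on S V"
    using V S by (auto simp: continuous_on_eq_continuous_at intro: differentiable_imp_continuous_within)
  have cont_f': "continuous_on UNIV (\<lambda>x. partial_deriv i \<psi> x \<bullet>\<bullet> V x + \<psi> x \<bullet>\<bullet> partial_deriv i V x)"
    proof (rule continuous_on_cutoff[OF _ S clK K(2)])
    show "continuous_on S (\<lambda>x. partial_deriv i \<psi> x \<bullet>\<bullet> V x + \<psi> x \<bullet>\<bullet> partial_deriv i V x)"
      using \<psi> continuous_on_C1[OF \<psi>]
      by (intro continuous_on_add continuous_on contV V') (auto intro: continuous_on_subset)
  qed (simp add: pd0 supp zero_left)
  show "integrable lborel (\<lambda>x. partial_deriv i \<psi> x \<bullet>\<bullet> V x + \<psi> x \<bullet>\<bullet> partial_deriv i V x)"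
    using cont_f' K(1) by (rule integrable_lborel_compact_support) (simp add: pd0 supp zero_left)
  let ?f = "\<lambda>x. \<psi> x \<bullet>\<bullet> V x"
  let ?f' = "\<lambda>x. partial_deriv i \<psi> x \<bullet>\<bullet> V x + \<psi> x \<bullet>\<bullet> partial_deriv i V x"
  have in_S: "(?f has_derivative (\<lambda>h. \<psi> x \<bullet>\<bullet> frechet_derivative V (at x) h
      + frechet_derivative \<psi> (at x) h \<bullet>\<bullet> V x)) (at x)" if "x \<in> S" for x
    using that V by (intro FDERIV C1_has_derivative[OF \<psi>]) (simp add: frechet_derivative_works[symmetric])
  have off_K: "(?f has_derivative (\<lambda>_. 0)) (at x)" if "x \<notin> K" for x
    by (rule has_derivative_transform_within_open[OF has_derivative_const[of 0], of "- K"])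
      (use clK that supp in \<open>auto simp: open_Compl zero_left\<close>)
  have pd_f: "partial_deriv i ?f = ?f'"
  proof
    fix x show "partial_deriv i ?f x = ?f' x"
    proof (cases "x \<in> K")
      case True
      then show ?thesis
        using partial_deriv_eq[OF in_S[of x]] K(2) by (auto simp: partial_deriv_def)
    next
      case False
      then show ?thesis
        using partial_deriv_eq[OF off_K[of x]] by (simp add: pd0 supp zero_left)
    qed
  qed
  have "integral\<^sup>L lborel (partial_deriv i ?f) = 0"
  proof (rule integral_partial_deriv_eq_0[OF _ _ K(1)])
    show "?f differentiable (at x)" for x
      using in_S[of x] off_K[of x] K(2) unfolding differentiable_def by blast
    show "continuous_on UNIV (partial_deriv i ?f)"
      unfolding pd_f by (rule cont_f')
  qed (simp add: supp zero_left)
  then show "integral\<^sup>L lborel ?f' = 0"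
    unfolding pd_f .
qed

section \<open>Integration by parts across a point singularity\<close>

text \<open>The function \<open>(max 0 s)\<^sup>2\<close> is the simplest one that is continuously differentiable,
  constant on a half line and not constant; the cutoff functions below are composed from it.\<close>

lemma DERIV_square_pos_part: "((\<lambda>s::real. (max 0 s)\<^sup>2) has_real_derivative 2 * max 0 s) (at s)"
proof (cases "s = 0")
  case True
  have "((\<lambda>h::real. (max 0 h)\<^sup>2 / h) \<longlongrightarrow> 0) (at 0)"
  proof (rule Lim_null_comparison[of _ "\<lambda>h. \<bar>h\<bar>"])
    show "\<forall>\<^sub>F h::real in at 0. norm ((max 0 h)\<^sup>2 / h) \<le> \<bar>h\<bar>"
      by (intro always_eventually) (auto simp: power2_eq_square max_def)
  qed (auto intro!: tendsto_eq_intros)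
  then show ?thesis using True by (simp add: DERIV_def)
next
  case False
  show ?thesis
  proof (cases "s > 0")
    case True
    have "((\<lambda>s::real. s\<^sup>2) has_real_derivative 2 * max 0 s) (at s)"
      using True by (auto intro!: derivative_eq_intros)
    then show ?thesis
      by (rule has_field_derivative_transform_within_open[of _ _ _ "{0<..}"]) (use True in auto)
  next
    case neg: False
    have "((\<lambda>s::real. 0) has_real_derivative 2 * max 0 s) (at s)"
      using neg by (auto intro!: derivative_eq_intros)
    then show ?thesis
      by (rule has_field_derivative_transform_within_open[of _ _ _ "{..<0}"]) (use False neg in auto)
  qed
qed

text \<open>The cutoff is \<open>h (|x|\<^sup>2 / \<epsilon>\<^sup>2)\<close> with \<open>h s = 1 - q (1 - q (s - 1))\<close> and
  \<open>q s = (max 0 s)\<^sup>2\<close>, so that \<open>h\<close> vanishes for \<open>s \<le> 1\<close>, is 1 for \<open>s \<ge> 2\<close> and has \<open>|h'| \<le> 4\<close>.\<close>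

lemma cutoff_near_0:
  fixes \<epsilon> :: real
  assumes "\<epsilon> > 0"
  obtains \<eta> :: "real^'n::finite \<Rightarrow> real" where
    "C_k (Suc 0) \<eta>" "\<And>x. 0 \<le> \<eta> x \<and> \<eta> x \<le> 1"
    "\<And>x. norm x \<le> \<epsilon> \<Longrightarrow> \<eta> x = 0" "\<And>x. norm x \<ge> 2 * \<epsilon> \<Longrightarrow> \<eta> x = 1"
    "\<And>i x. \<bar>partial_deriv i \<eta> x\<bar> \<le> 16 / \<epsilon>"
    "\<And>i x. norm x \<le> \<epsilon> \<or> norm x \<ge> 2 * \<epsilon> \<Longrightarrow> partial_deriv i \<eta> x = 0"
proof -
  define q :: "real \<Rightarrow> real" where "q s = (max 0 s)\<^sup>2" for s
  define h where "h s = 1 - q (1 - q (s - 1))" for s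
  define h' where "h' s = 2 * max 0 (1 - q (s - 1)) * (2 * max 0 (s - 1))" for s
  define \<eta> :: "real^'n \<Rightarrow> real" where "\<eta> x = h (x \<bullet> x / \<epsilon>\<^sup>2)" for x
  have q: "(q has_real_derivative 2 * max 0 s) (at s)" for s
    unfolding q_def by (rule DERIV_square_pos_part)
  have h: "(h has_real_derivative h' s) (at s)" for s
    unfolding h_def h'_def
    by (auto intro!: derivative_eq_intros DERIV_chain2[OF q])
  have q_bounds: "q s \<ge> 0" "s \<le> 1 \<Longrightarrow> q s \<le> 1" "s \<le> 0 \<Longrightarrow> q s = 0" "s \<ge> 1 \<Longrightarrow> q s \<ge> 1" for s
    unfolding q_def by (auto simp: power_le_one max_def)
  have h_bounds: "0 \<le> h s \<and> h s \<le> 1" for s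
    using q_bounds(1,2)[of "1 - q (s - 1)"] q_bounds(1)[of "s - 1"] by (auto simp: h_def)
  have h01: "s \<le> 1 \<Longrightarrow> h s = 0 \<and> h' s = 0" "s \<ge> 2 \<Longrightarrow> h s = 1 \<and> h' s = 0" for s
    using q_bounds(3,4)[of "s - 1"] q_bounds(3)[of "1 - q (s - 1)"]
    by (auto simp: h_def h'_def) (auto simp: q_def)
  have h'_bound: "\<bar>h' s\<bar> \<le> 4" for s
  proof (cases "s \<le> 2")
    case True
    have "h' s \<le> 2 * 1 * (2 * 1)"
      unfolding h'_def using True q_bounds(1)[of "s - 1"] by (intro mult_mono) auto
    then show ?thesis by (simp add: h'_def)
  qed (use h01(2)[of s] in auto)
  have s_small: "x \<bullet> x / \<epsilon>\<^sup>2 \<le> 1" if "norm x \<le> \<epsilon>" for x :: "real^'n"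
    using that assms by (simp add: dot_square_norm divide_simps power_mono)
  have s_large: "x \<bullet> x / \<epsilon>\<^sup>2 \<ge> 2" if "norm x \<ge> 2 * \<epsilon>" for x :: "real^'n"
  proof -
    have "(2 * \<epsilon>)\<^sup>2 \<le> (norm x)\<^sup>2"
      using that assms by (intro power_mono) auto
    moreover have "2 * \<epsilon>\<^sup>2 \<le> (2 * \<epsilon>)\<^sup>2"
      by (simp add: power_mult_distrib)
    ultimately have "2 * \<epsilon>\<^sup>2 \<le> (norm x)\<^sup>2"
      by linarith
    then show ?thesis
      using assms by (simp add: dot_square_norm divide_simps)
  qed
  have deriv_sq: "((\<lambda>x. x \<bullet> x / \<epsilon>\<^sup>2) has_derivative (\<lambda>v. 2 * (x \<bullet> v) / \<epsilon>\<^sup>2)) (at x)" for x :: "real^'n"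
    by (rule bounded_linear.has_derivative[OF bounded_linear_divide])
      (auto intro!: derivative_eq_intros simp: inner_commute)
  have deriv: "(\<eta> has_derivative (\<lambda>v. h' (x \<bullet> x / \<epsilon>\<^sup>2) * (2 * (x \<bullet> v) / \<epsilon>\<^sup>2))) (at x)" for x
    unfolding \<eta>_def
    by (rule has_derivative_compose[OF deriv_sq h[unfolded has_field_derivative_def]])
  have pd: "partial_deriv i \<eta> x = h' (x \<bullet> x / \<epsilon>\<^sup>2) * (2 * x $ i / \<epsilon>\<^sup>2)" for i x
    by (simp add: partial_deriv_eq[OF deriv] inner_axis)
  have pd0: "partial_deriv i \<eta> x = 0" if "norm x \<le> \<epsilon> \<or> norm x \<ge> 2 * \<epsilon>" for i x
    using that h01 s_small s_large by (auto simp: pd)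
  have cont_q: "continuous_on A q" for A
    unfolding q_def by (intro continuous_intros)
  have "continuous_on UNIV (partial_deriv i \<eta>)" for i
    unfolding pd[abs_def] h'_def
    by (intro continuous_intros continuous_on_compose2[OF cont_q]) (use assms in auto)
  then have "C_k (Suc 0) \<eta>"
    using deriv by (auto simp: differentiable_def)
  moreover have "\<bar>partial_deriv i \<eta> x\<bar> \<le> 16 / \<epsilon>" for i x
  proof (cases "norm x \<ge> 2 * \<epsilon>")
    case False
    have "\<bar>partial_deriv i \<eta> x\<bar> = \<bar>h' (x \<bullet> x / \<epsilon>\<^sup>2)\<bar> * (2 * \<bar>x $ i\<bar> / \<epsilon>\<^sup>2)"
      by (simp add: pd abs_mult)
    also have "\<dots> \<le> 4 * (2 * (2 * \<epsilon>) / \<epsilon>\<^sup>2)"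
      using False assms component_le_norm_cart[of x i]
      by (intro mult_mono divide_right_mono h'_bound) auto
    also have "\<dots> = 16 / \<epsilon>"
      using assms by (simp add: power2_eq_square)
    finally show ?thesis .
  qed (use pd0[of x i] assms in auto)
  ultimately show thesis
    using pd0 h_bounds h01 s_small s_large by (intro that[of \<eta>]) (auto simp: \<eta>_def)
qed

lemma integral_lebesgue_on_eq:
  fixes f :: "'a::euclidean_space \<Rightarrow> 'b::euclidean_space"
  assumes "\<Omega> \<in> sets lebesgue" "\<And>x. x \<notin> \<Omega> \<Longrightarrow> f x = 0"
  shows "integrable (lebesgue_on \<Omega>) f \<longleftrightarrow> integrable lebesgue f"
    and "integral\<^sup>L (lebesgue_on \<Omega>) f = integral\<^sup>L lebesgue f"
proof -
  have "(\<lambda>x. indicator \<Omega> x *\<^sub>R f x) = f"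
    using assms(2) by (auto simp: indicator_def fun_eq_iff)
  then show "integrable (lebesgue_on \<Omega>) f \<longleftrightarrow> integrable lebesgue f"
    "integral\<^sup>L (lebesgue_on \<Omega>) f = integral\<^sup>L lebesgue f"
    using assms(1) by (simp_all add: integrable_restrict_space integral_restrict_space)
qed

text \<open>Test functions are bounded, so all the pairings that occur in weak formulations are
  integrable.\<close>

lemma integrable_bounded_bilinear:
  fixes prod :: "'a::euclidean_space \<Rightarrow> 'b::euclidean_space \<Rightarrow> 'c::euclidean_space"
  assumes "bounded_bilinear prod" and a: "a \<in> borel_measurable M" "\<And>x. norm (a x) \<le> C"
    and V: "integrable M V"
  shows "integrable M (\<lambda>x. prod (a x) (V x))"
proof -
  interpret bounded_bilinear prod by fact
  obtain L where L: "L > 0" "\<And>a b. norm (prod a b) \<le> norm a * norm b * L"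
    using pos_bounded by blast
  show ?thesis
  proof (rule Bochner_Integration.integrable_bound)
    show "integrable M (\<lambda>x. C * L * norm (V x))"
      using V by auto
    show "(\<lambda>x. prod (a x) (V x)) \<in> borel_measurable M"
      using a V by (intro borel_measurable_continuous_Pair[where H = prod])
        (auto intro!: continuous_on continuous_intros)
    have "norm (prod (a x) (V x)) \<le> norm (C * L * norm (V x))" for x
    proof -
      have "norm (prod (a x) (V x)) \<le> norm (a x) * norm (V x) * L" by (rule L)
      also have "\<dots> \<le> C * norm (V x) * L"
        using a(2)[of x] L(1) by (intro mult_right_mono) auto
      also have "\<dots> \<le> \<bar>C * L * norm (V x)\<bar>" by (simp add: mult_ac)
      finally show ?thesis by simp
    qed
    then show "AE x in M. norm (prod (a x) (V x)) \<le> norm (C * L * norm (V x))" by simp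
  qed
qed

text \<open>Removal of a point singularity. Integrating \<open>div (\<eta> \<phi> V)\<close> for a cutoff \<open>\<eta>\<close> that vanishes
  near 0 leaves, besides the terms that converge to the two sides, an error \<open>\<nabla>\<eta> \<cdot> \<phi> V\<close>. It lives
  on the ball of radius \<open>2\<epsilon>\<close>, where \<open>|\<nabla>\<eta>|\<close> is of order \<open>1/\<epsilon>\<close> and \<open>V\<close> is \<open>o(\<epsilon>\<^bsup>1-n\<^esup>)\<close>; as the ball
  has volume of order \<open>\<epsilon>\<^bsup>n\<^esup>\<close>, the error tends to 0. The rate \<open>1 - n\<close> is the one at which the
  flux of \<open>V\<close> through small spheres vanishes.

  Only the divergence \<open>g\<close> as a whole is assumed integrable: for the gradient of the Laplacian of
  the map studied below, the single terms \<open>\<partial>\<^sub>i V\<^sub>i\<close> are of order \<open>1 / (|x|\<^sup>4 |ln |x||)\<close>, which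
  is not integrable in dimension four.\<close>

lemma integration_by_parts_punctured:
  fixes prod :: "'a::euclidean_space \<Rightarrow> 'b::euclidean_space \<Rightarrow> 'c::euclidean_space" (infixl \<open>\<bullet>\<bullet>\<close> 70)
    and \<phi> :: "real^'n::finite \<Rightarrow> 'a" and V :: "'n \<Rightarrow> real^'n \<Rightarrow> 'b"
  assumes bil: "bounded_bilinear prod" and \<Omega>: "\<Omega> \<in> sets lebesgue"
    and \<phi>: "C_k (Suc 0) \<phi>" and K: "compact K" "K \<subseteq> interior \<Omega>"
    and supp: "\<And>x. x \<notin> K \<Longrightarrow> \<phi> x = 0"
    and V: "\<And>i x. x \<in> interior \<Omega> - {0} \<Longrightarrow> V i differentiable (at x)"
    and V': "\<And>i. continuous_on (interior \<Omega> - {0}) (partial_deriv i (V i))"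
    and g: "\<And>x. x \<in> interior \<Omega> - {0} \<Longrightarrow> g x = (\<Sum>i\<in>UNIV. partial_deriv i (V i) x)"
    and intV: "\<And>i. integrable (lebesgue_on \<Omega>) (V i)" and intg: "integrable (lebesgue_on \<Omega>) g"
    and decay: "\<And>i. ((\<lambda>x. norm x ^ (CARD('n) - 1) *\<^sub>R V i x) \<longlongrightarrow> 0) (at 0)"
  shows "integral\<^sup>L (lebesgue_on \<Omega>) (\<lambda>x. \<Sum>i\<in>UNIV. partial_deriv i \<phi> x \<bullet>\<bullet> V i x)
    = - integral\<^sup>L (lebesgue_on \<Omega>) (\<lambda>x. \<phi> x \<bullet>\<bullet> g x)"
proof -
  interpret bounded_bilinear prod by (rule bil)
  let ?n = "CARD('n)"
  have clK: "closed K" using K(1) by (rule compact_imp_closed)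
  have K\<Omega>: "K \<subseteq> \<Omega>" using K(2) interior_subset by blast
  have pd0: "partial_deriv i \<phi> x = 0" if "x \<notin> K" for x i
    using partial_deriv_eq_0_outside[OF clK supp that] .
  have cont\<phi>: "continuous_on A \<phi>" "continuous_on A (partial_deriv i \<phi>)" for A i
    using continuous_on_C1[OF \<phi>] \<phi> by (auto intro: continuous_on_subset)
  have meas\<phi>: "\<phi> \<in> borel_measurable (lebesgue_on \<Omega>)" "partial_deriv i \<phi> \<in> borel_measurable (lebesgue_on \<Omega>)" for i
    by (intro continuous_imp_measurable_on_sets_lebesgue cont\<phi> \<Omega>)+
  obtain C where C: "C > 0" "\<And>x. norm (\<phi> x) \<le> C"
    using bounded_compact_support[OF cont\<phi>(1) K(1) supp] by blast
  obtain L where L: "L > 0" "\<And>a b. norm (a \<bullet>\<bullet> b) \<le> norm a * norm b * L"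
    using pos_bounded by blast
  \<comment> \<open>The claim is that \<open>D\<close>, the divergence of \<open>\<phi> V\<close> away from 0, has integral 0.\<close>
  define A where "A x = (\<Sum>i\<in>UNIV. partial_deriv i \<phi> x \<bullet>\<bullet> V i x)" for x
  define D where "D x = A x + \<phi> x \<bullet>\<bullet> g x" for x
  have A_int: "integrable (lebesgue_on \<Omega>) A"
    unfolding A_def
  proof (rule Bochner_Integration.integrable_sum)
    fix i
    obtain C' where "\<And>x. norm (partial_deriv i \<phi> x) \<le> C'"
      using bounded_compact_support[OF cont\<phi>(2) K(1) pd0] by blast
    then show "integrable (lebesgue_on \<Omega>) (\<lambda>x. partial_deriv i \<phi> x \<bullet>\<bullet> V i x)"
      by (rule integrable_bounded_bilinear[OF bil meas\<phi>(2) _ intV])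
  qed
  have g_int: "integrable (lebesgue_on \<Omega>) (\<lambda>x. \<phi> x \<bullet>\<bullet> g x)"
    using C(2) by (rule integrable_bounded_bilinear[OF bil meas\<phi>(1) _ intg])
  have D0: "D x = 0" if "x \<notin> K" for x
    using that by (simp add: D_def A_def pd0 supp zero_left)
  have D_int: "integrable lebesgue D"
    using A_int g_int D0 K\<Omega>
    by (subst integral_lebesgue_on_eq(1)[OF \<Omega>, symmetric]) (auto simp: D_def[abs_def])

  define \<epsilon> where "\<epsilon> k = inverse (real (Suc k))" for k
  have \<epsilon>: "\<epsilon> k > 0" for k by (simp add: \<epsilon>_def)
  have \<epsilon>0: "\<epsilon> \<longlonglongrightarrow> 0" unfolding \<epsilon>_def by (rule LIMSEQ_inverse_real_of_nat)
  have "\<exists>\<eta> :: real^'n \<Rightarrow> real. C_k (Suc 0) \<eta> \<and> (\<forall>x. 0 \<le> \<eta> x \<and> \<eta> x \<le> 1) \<and>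
    (\<forall>x. norm x \<le> \<epsilon> k \<longrightarrow> \<eta> x = 0) \<and> (\<forall>x. norm x \<ge> 2 * \<epsilon> k \<longrightarrow> \<eta> x = 1) \<and>
    (\<forall>i x. \<bar>partial_deriv i \<eta> x\<bar> \<le> 16 / \<epsilon> k) \<and>
    (\<forall>i x. norm x \<le> \<epsilon> k \<or> norm x \<ge> 2 * \<epsilon> k \<longrightarrow> partial_deriv i \<eta> x = 0)" for k
    by (rule cutoff_near_0[OF \<epsilon>[of k]]) blast
  then obtain \<eta> :: "nat \<Rightarrow> real^'n \<Rightarrow> real" where \<eta>: "\<And>k. C_k (Suc 0) (\<eta> k)"
    "\<And>k x. 0 \<le> \<eta> k x \<and> \<eta> k x \<le> 1" "\<And>k x. norm x \<le> \<epsilon> k \<Longrightarrow> \<eta> k x = 0"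
    "\<And>k x. norm x \<ge> 2 * \<epsilon> k \<Longrightarrow> \<eta> k x = 1" "\<And>k i x. \<bar>partial_deriv i (\<eta> k) x\<bar> \<le> 16 / \<epsilon> k"
    "\<And>k i x. norm x \<le> \<epsilon> k \<or> norm x \<ge> 2 * \<epsilon> k \<Longrightarrow> partial_deriv i (\<eta> k) x = 0"
    by metis
  \<comment> \<open>The error term, that is, the part of the divergence that comes from differentiating the cutoff.\<close>
  define E where "E k x = (\<Sum>i\<in>UNIV. partial_deriv i (\<eta> k) x *\<^sub>R (\<phi> x \<bullet>\<bullet> V i x))" for k x
  have cont\<eta>: "continuous_on S (\<eta> k)" "continuous_on S (partial_deriv i (\<eta> k))" for k S i
    using continuous_on_C1[OF \<eta>(1)] \<eta>(1)[of k] by (auto intro: continuous_on_subset)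
  have meas\<eta>: "\<eta> k \<in> borel_measurable lebesgue" for k
    by (rule measurable_completion) (simp add: borel_measurable_continuous_onI[OF cont\<eta>(1)])
  have \<eta>D_int: "integrable lebesgue (\<lambda>x. \<eta> k x *\<^sub>R D x)" for k
    using \<eta>(2) by (intro integrable_bounded_bilinear[OF bounded_bilinear_scaleR meas\<eta> _ D_int, of _ 1]) auto
  have cut: "integrable lebesgue (\<lambda>x. \<eta> k x *\<^sub>R D x + E k x)"
    "integral\<^sup>L lebesgue (\<lambda>x. \<eta> k x *\<^sub>R D x + E k x) = 0" for k
  proof -
    define \<psi> where "\<psi> x = \<eta> k x *\<^sub>R \<phi> x" for x
    have d\<psi>: "(\<psi> has_derivative (\<lambda>h. \<eta> k x *\<^sub>R frechet_derivative \<phi> (at x) h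
        + frechet_derivative (\<eta> k) (at x) h *\<^sub>R \<phi> x)) (at x)" for x
      unfolding \<psi>_def
      by (rule bounded_bilinear.FDERIV[OF bounded_bilinear_scaleR
            C1_has_derivative[OF \<eta>(1)] C1_has_derivative[OF \<phi>]])
    have pd\<psi>: "partial_deriv i \<psi> x = \<eta> k x *\<^sub>R partial_deriv i \<phi> x + partial_deriv i (\<eta> k) x *\<^sub>R \<phi> x" for i x
      using partial_deriv_eq[OF d\<psi>] by (simp add: partial_deriv_def)
    have \<psi>C1: "C_k (Suc 0) \<psi>"
      using d\<psi> by (auto simp: differentiable_def pd\<psi>[abs_def] intro!: continuous_intros cont\<phi> cont\<eta>)
    have supp\<psi>: "\<psi> x = 0" if "x \<notin> K - ball 0 (\<epsilon> k)" for x
      using that \<eta>(3)[of x k] supp[of x] by (auto simp: \<psi>_def)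
    have ibp: "integrable lborel (\<lambda>x. partial_deriv i \<psi> x \<bullet>\<bullet> V i x + \<psi> x \<bullet>\<bullet> partial_deriv i (V i) x)"
      "integral\<^sup>L lborel (\<lambda>x. partial_deriv i \<psi> x \<bullet>\<bullet> V i x + \<psi> x \<bullet>\<bullet> partial_deriv i (V i) x) = 0" for i
    proof -
      have K': "compact (K - ball 0 (\<epsilon> k))" "K - ball 0 (\<epsilon> k) \<subseteq> interior \<Omega> - {0}"
        using K \<epsilon>[of k] by (auto simp: compact_diff)
      note * = integration_by_parts_compact_support[OF bil \<psi>C1 K' open_delete[OF open_interior] supp\<psi> V V']
      show "integrable lborel (\<lambda>x. partial_deriv i \<psi> x \<bullet>\<bullet> V i x + \<psi> x \<bullet>\<bullet> partial_deriv i (V i) x)"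
        by (rule *(1))
      show "integral\<^sup>L lborel (\<lambda>x. partial_deriv i \<psi> x \<bullet>\<bullet> V i x + \<psi> x \<bullet>\<bullet> partial_deriv i (V i) x) = 0"
        by (rule *(2))
    qed
    have eq: "\<eta> k x *\<^sub>R D x + E k x
        = (\<Sum>i\<in>UNIV. partial_deriv i \<psi> x \<bullet>\<bullet> V i x + \<psi> x \<bullet>\<bullet> partial_deriv i (V i) x)" for x
    proof -
      have "\<eta> k x *\<^sub>R (\<phi> x \<bullet>\<bullet> g x) = (\<Sum>i\<in>UNIV. \<psi> x \<bullet>\<bullet> partial_deriv i (V i) x)"
      proof (cases "x \<in> interior \<Omega> - {0}")
        case True
        then show ?thesis by (simp add: g \<psi>_def sum_right scaleR_left scaleR_sum_right)
      next
        case False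
        then have "\<psi> x = 0"
          using \<eta>(3)[of x k] \<epsilon>[of k] supp[of x] K(2) by (auto simp: \<psi>_def)
        then show ?thesis by (auto simp: \<psi>_def zero_left)
      qed
      then show ?thesis
        by (simp add: D_def A_def E_def pd\<psi> scaleR_add_right scaleR_sum_right sum.distrib
            add_left scaleR_left algebra_simps)
    qed
    have lb: "integrable lborel (\<lambda>x. \<eta> k x *\<^sub>R D x + E k x)"
      "integral\<^sup>L lborel (\<lambda>x. \<eta> k x *\<^sub>R D x + E k x) = 0"
      unfolding eq using ibp by auto
    then show "integrable lebesgue (\<lambda>x. \<eta> k x *\<^sub>R D x + E k x)"
      "integral\<^sup>L lebesgue (\<lambda>x. \<eta> k x *\<^sub>R D x + E k x) = 0"
      by (auto simp: integral_completion integrable_completion)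
  qed
  have E_int: "integrable lebesgue (E k)" for k
    using Bochner_Integration.integrable_diff[OF cut(1) \<eta>D_int, of k k] by simp
  have cutE: "integral\<^sup>L lebesgue (\<lambda>x. \<eta> k x *\<^sub>R D x) = - integral\<^sup>L lebesgue (E k)" for k
    using cut(2)[of k] \<eta>D_int[of k] E_int[of k] by (simp add: eq_neg_iff_add_eq_0)

  have lim1: "(\<lambda>k. integral\<^sup>L lebesgue (\<lambda>x. \<eta> k x *\<^sub>R D x)) \<longlonglongrightarrow> integral\<^sup>L lebesgue D"
  proof (rule integral_dominated_convergence[where w = "\<lambda>x. norm (D x)"])
    show "AE x in lebesgue. (\<lambda>k. \<eta> k x *\<^sub>R D x) \<longlonglongrightarrow> D x"
    proof (rule AE_mp[OF AE_not_in[of "{0}"]]; (intro AE_I2 impI)?)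
      fix x :: "real^'n" assume "x \<notin> {0}"
      then have "\<forall>\<^sub>F k in sequentially. 2 * \<epsilon> k < norm x"
        using order_tendstoD(2)[OF \<epsilon>0, of "norm x / 2"] by (auto elim: eventually_mono)
      then have "\<forall>\<^sub>F k in sequentially. \<eta> k x *\<^sub>R D x = D x"
        by eventually_elim (simp add: \<eta>(4))
      then show "(\<lambda>k. \<eta> k x *\<^sub>R D x) \<longlonglongrightarrow> D x"
        by (rule tendsto_eventually)
    qed auto
    show "AE x in lebesgue. norm (\<eta> k x *\<^sub>R D x) \<le> norm (D x)" for k
      using \<eta>(2) by (intro AE_I2) (auto simp: mult_left_le_one_le)
  qed (use D_int \<eta>D_int in auto)

  have lim2: "(\<lambda>k. integral\<^sup>L lebesgue (E k)) \<longlonglongrightarrow> 0"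
  proof (rule LIMSEQ_I)
    fix r :: real assume "r > 0"
    \<comment> \<open>\<open>M\<close> collects the constants in the bound of the error: 16 from the gradient of the cutoff and
      \<open>2\<^bsup>n\<^esup>\<close> from the ball of radius \<open>2\<epsilon>\<close>; the powers of \<open>\<epsilon>\<close> cancel.\<close>
    define \<omega> where "\<omega> = measure lborel (ball (0::real^'n) 1)"
    define M where "M = real ?n * (16 * C * L) * 2 ^ ?n * \<omega>"
    have "\<omega> \<ge> 0" by (simp add: \<omega>_def)
    then have "M \<ge> 0" using C(1) L(1) by (simp add: M_def)
    define \<delta> where "\<delta> = r / (M + 1)"
    have \<delta>: "\<delta> > 0" "M * \<delta> < r"
      using \<open>r > 0\<close> \<open>M \<ge> 0\<close> by (auto simp: \<delta>_def field_simps)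
    have "\<forall>\<^sub>F x in at 0. norm (norm x ^ (?n - 1) *\<^sub>R V i x) < \<delta>" for i
      using tendstoD[OF decay[of i] \<delta>(1)] by (simp add: dist_norm)
    then have "\<forall>\<^sub>F x in at 0. \<forall>i. norm (norm x ^ (?n - 1) *\<^sub>R V i x) < \<delta>"
      by (simp add: eventually_all_finite)
    then obtain d where d: "d > 0" "\<And>x i. x \<noteq> 0 \<Longrightarrow> norm x < d \<Longrightarrow> norm x ^ (?n - 1) * norm (V i x) < \<delta>"
      by (auto simp: eventually_at dist_norm)
    obtain N where N: "\<And>k. k \<ge> N \<Longrightarrow> \<epsilon> k < d / 2"
      using order_tendstoD(2)[OF \<epsilon>0, of "d / 2"] d(1) by (auto simp: eventually_sequentially)
    have "norm (integral\<^sup>L lebesgue (E k)) < r" if "k \<ge> N" for k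
    proof -
      define c where "c = real ?n * (16 * C * L) * \<delta> / \<epsilon> k ^ ?n"
      have "c \<ge> 0" using C(1) L(1) \<delta>(1) \<epsilon>[of k] by (simp add: c_def)
      have bound: "norm (E k x) \<le> indicator (ball 0 (2 * \<epsilon> k)) x * c" for x
      proof (cases "\<epsilon> k < norm x \<and> norm x < 2 * \<epsilon> k")
        case True
        have Vi: "norm (V i x) \<le> \<delta> / \<epsilon> k ^ (?n - 1)" for i
        proof -
          have "\<epsilon> k ^ (?n - 1) * norm (V i x) \<le> norm x ^ (?n - 1) * norm (V i x)"
            using True \<epsilon>[of k] by (intro mult_right_mono power_mono) auto
          also have "\<dots> < \<delta>"
            using True \<epsilon>[of k] N[OF that] by (intro d(2)) auto
          finally show ?thesis using \<epsilon>[of k] by (simp add: field_simps)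
        qed
        have "norm (E k x) \<le> (\<Sum>i\<in>(UNIV::'n set). 16 / \<epsilon> k * (C * (\<delta> / \<epsilon> k ^ (?n - 1)) * L))"
          unfolding E_def
        proof (rule sum_norm_le)
          fix i
          have "norm (\<phi> x \<bullet>\<bullet> V i x) \<le> norm (\<phi> x) * norm (V i x) * L" by (rule L)
          also have "\<dots> \<le> C * (\<delta> / \<epsilon> k ^ (?n - 1)) * L"
            using C Vi[of i] L(1) by (intro mult_right_mono mult_mono) auto
          finally have "norm (\<phi> x \<bullet>\<bullet> V i x) \<le> C * (\<delta> / \<epsilon> k ^ (?n - 1)) * L" .
          then show "norm (partial_deriv i (\<eta> k) x *\<^sub>R (\<phi> x \<bullet>\<bullet> V i x))
              \<le> 16 / \<epsilon> k * (C * (\<delta> / \<epsilon> k ^ (?n - 1)) * L)"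
            unfolding norm_scaleR real_norm_def by (rule mult_mono[OF \<eta>(5)]) (use \<epsilon>[of k] in auto)
        qed
        also have "\<dots> = c"
        proof -
          have "\<epsilon> k ^ ?n = \<epsilon> k * \<epsilon> k ^ (?n - 1)"
            by (simp add: power_eq_if)
          then show ?thesis
            by (simp add: c_def)
        qed
        finally show ?thesis using True by simp
      next
        case False
        then show ?thesis
          using \<open>c \<ge> 0\<close> \<eta>(6)[of x k] by (auto simp: E_def)
      qed
      have "norm (integral\<^sup>L lebesgue (E k)) \<le> integral\<^sup>L lebesgue (\<lambda>x. norm (E k x))"
        by (rule integral_norm_bound)
      moreover have "integral\<^sup>L lebesgue (\<lambda>x. norm (E k x))
          \<le> integral\<^sup>L lebesgue (\<lambda>x::real^'n. indicator (ball 0 (2 * \<epsilon> k)) x * c)"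
      proof (rule integral_mono)
        show "integrable lebesgue (\<lambda>x::real^'n. indicator (ball 0 (2 * \<epsilon> k)) x * c)"
          by (intro integrable_mult_left integrable_real_indicator)
            (use emeasure_lborel_ball_finite[of "0::real^'n" "2 * \<epsilon> k"] in auto)
        show "integrable lebesgue (\<lambda>x. norm (E k x))"
          by (rule integrable_norm[OF E_int])
      qed (rule bound)
      moreover have "integral\<^sup>L lebesgue (\<lambda>x::real^'n. indicator (ball 0 (2 * \<epsilon> k)) x * c)
          = measure lborel (ball (0::real^'n) (2 * \<epsilon> k)) * c"
        by simp
      moreover have "measure lborel (ball (0::real^'n) (2 * \<epsilon> k)) * c = M * \<delta>"
        using \<epsilon>[of k] content_ball_conv_unit_ball[of "2 * \<epsilon> k" "0::real^'n"]
        by (simp add: M_def c_def \<omega>_def power_mult_distrib)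
      ultimately show ?thesis using \<delta>(2) by linarith
    qed
    then show "\<exists>N. \<forall>k\<ge>N. norm (integral\<^sup>L lebesgue (E k) - 0) < r" by auto
  qed
  have "integral\<^sup>L lebesgue D = 0"
    using LIMSEQ_unique[OF lim1, of 0] tendsto_minus[OF lim2] by (simp add: cutE)
  then have "integral\<^sup>L (lebesgue_on \<Omega>) D = 0"
    using integral_lebesgue_on_eq(2)[OF \<Omega>, of D] D0 K\<Omega> by auto
  then show ?thesis
    using A_int g_int unfolding D_def A_def[symmetric] by (simp add: eq_neg_iff_add_eq_0)
qed

section \<open>Derivatives of radial functions\<close>

text \<open>Radial functions are written as \<open>F (ln |x|)\<close>. In the variable \<open>s = ln |x|\<close> the Laplacian
  on \<open>\<real>\<^sup>n\<close> is \<open>e\<^bsup>-2s\<^esup> (F'' + (n - 2) F')\<close>, again a radial function, and all coefficients are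
  constant up to the exponential. Iterating the Laplacian is therefore a computation with
  functions of one real variable.\<close>

lemma has_derivative_ln_norm:
  fixes x :: "'a::euclidean_space"
  assumes "x \<noteq> 0"
  shows "((\<lambda>x. ln (norm x)) has_derivative (\<lambda>v. (x \<bullet> v) / (norm x)\<^sup>2)) (at x)"
proof -
  have "(norm has_derivative (\<lambda>v. (x \<bullet> v) / norm x)) (at x)"
    by (rule has_derivative_eq_rhs[OF has_derivative_norm[OF assms]])
      (simp add: fun_eq_iff sgn_div_norm inner_commute divide_inverse mult.commute)
  then show ?thesis
    using assms
    by (auto intro!: has_derivative_eq_rhs[OF has_derivative_ln] simp: fun_eq_iff power2_eq_square field_simps)
qed

lemma has_derivative_radial:
  fixes x :: "'a::euclidean_space"
  assumes "x \<noteq> 0" "(F has_vector_derivative F') (at (ln (norm x)))"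
  shows "((\<lambda>x. F (ln (norm x))) has_derivative (\<lambda>v. ((x \<bullet> v) / (norm x)\<^sup>2) *\<^sub>R F')) (at x)"
  using has_derivative_compose[OF has_derivative_ln_norm[OF assms(1)]
      assms(2)[unfolded has_vector_derivative_def]] by simp

text \<open>The first and second partial derivatives of \<open>F (ln |x|)\<close>, in terms of the derivatives \<open>F'\<close>
  and \<open>F''\<close>. The Hessian takes \<open>i\<close> as the index of the inner differentiation.\<close>

definition radial_grad :: "(real \<Rightarrow> 'b::real_normed_vector) \<Rightarrow> 'n::finite \<Rightarrow> real^'n \<Rightarrow> 'b" where
  "radial_grad F' i x = (x $ i / (norm x)\<^sup>2) *\<^sub>R F' (ln (norm x))"

definition radial_hess ::
  "(real \<Rightarrow> 'b::real_normed_vector) \<Rightarrow> (real \<Rightarrow> 'b) \<Rightarrow> 'n::finite \<Rightarrow> 'n \<Rightarrow> real^'n \<Rightarrow> 'b" where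
  "radial_hess F' F'' i j x =
     (axis j 1 $ i / (norm x)\<^sup>2 - 2 * (x $ i * x $ j) / norm x ^ 4) *\<^sub>R F' (ln (norm x))
     + (x $ i * x $ j / norm x ^ 4) *\<^sub>R F'' (ln (norm x))"

lemma partial_deriv_radial:
  assumes "x \<noteq> 0" "(F has_vector_derivative F' (ln (norm x))) (at (ln (norm x)))"
  shows "partial_deriv i (\<lambda>x. F (ln (norm x))) x = radial_grad F' i x"
  unfolding partial_deriv_eq[OF has_derivative_radial[of x F, OF assms]]
  by (simp add: radial_grad_def inner_axis)

lemma has_derivative_radial_grad:
  fixes x :: "real^'n::finite"
  assumes "x \<noteq> 0" "(F' has_vector_derivative F'' (ln (norm x))) (at (ln (norm x)))"
  shows "(radial_grad F' i has_derivative
     (\<lambda>v. (v $ i / (norm x)\<^sup>2 - 2 * (x $ i * (x \<bullet> v)) / norm x ^ 4) *\<^sub>R F' (ln (norm x))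
       + (x $ i * (x \<bullet> v) / norm x ^ 4) *\<^sub>R F'' (ln (norm x)))) (at x)"
proof -
  have r: "((\<lambda>x. inverse (x \<bullet> x)) has_derivative (\<lambda>v. - (2 * (x \<bullet> v)) / norm x ^ 4)) (at x)"
    using assms(1)
    by (auto intro!: derivative_eq_intros simp: fun_eq_iff inner_commute dot_square_norm
        power_mult[symmetric] field_simps)
  have "((\<lambda>x. x $ i) has_derivative (\<lambda>v. v $ i)) (at x)"
    by (rule bounded_linear_imp_has_derivative) (rule bounded_linear_vec_nth)
  from has_derivative_mult[OF this r]
  have "((\<lambda>x. x $ i * inverse (x \<bullet> x)) has_derivative
      (\<lambda>v. v $ i / (norm x)\<^sup>2 - 2 * (x $ i * (x \<bullet> v)) / norm x ^ 4)) (at x)"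
    by (rule has_derivative_eq_rhs) (simp add: fun_eq_iff dot_square_norm divide_inverse)
  then have "((\<lambda>x. x $ i / (norm x)\<^sup>2) has_derivative
      (\<lambda>v. v $ i / (norm x)\<^sup>2 - 2 * (x $ i * (x \<bullet> v)) / norm x ^ 4)) (at x)"
    by (simp add: dot_square_norm divide_inverse)
  from has_derivative_scaleR[OF this has_derivative_radial[of x F', OF assms]]
  show ?thesis
    unfolding radial_grad_def
    by (rule has_derivative_eq_rhs) (use assms(1) in \<open>auto simp: fun_eq_iff field_simps power2_eq_square power4_eq_xxxx\<close>)
qed

lemma partial_deriv_radial_grad:
  assumes "x \<noteq> 0" "(F' has_vector_derivative F'' (ln (norm x))) (at (ln (norm x)))"
  shows "partial_deriv j (radial_grad F' i) x = radial_hess F' F'' i j x"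
  unfolding partial_deriv_eq[OF has_derivative_radial_grad[of x F' F'', OF assms]]
  by (simp add: radial_hess_def inner_axis)

lemma continuous_on_radial:
  fixes S :: "'a::real_normed_vector set"
  assumes "continuous_on T F" "\<And>x. x \<in> S \<Longrightarrow> x \<noteq> 0 \<and> ln (norm x) \<in> T"
  shows "continuous_on S (\<lambda>x. F (ln (norm x)))"
  using assms(2) by (intro continuous_on_compose2[OF assms(1)] continuous_intros) auto

lemma continuous_on_radial_grad:
  assumes "continuous_on T F'" "\<And>x. x \<in> S \<Longrightarrow> x \<noteq> 0 \<and> ln (norm x) \<in> T"
  shows "continuous_on S (radial_grad F' i)"
  unfolding radial_grad_def
  using assms(2) by (intro continuous_intros continuous_on_radial[OF assms]) auto

lemma continuous_on_radial_hess:
  assumes "continuous_on T F'" "continuous_on T F''" "\<And>x. x \<in> S \<Longrightarrow> x \<noteq> 0 \<and> ln (norm x) \<in> T"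
  shows "continuous_on S (radial_hess F' F'' i j)"
  unfolding radial_hess_def
  using assms(3) by (intro continuous_intros continuous_on_radial[OF assms(1,3)] continuous_on_radial[OF assms(2,3)]) auto

lemma borel_measurable_vec_nth [measurable]: "(\<lambda>x::real^'n. x $ i) \<in> borel_measurable borel"
  by (intro borel_measurable_continuous_onI continuous_intros)

lemma borel_measurable_radial_grad [measurable]:
  fixes F' :: "real \<Rightarrow> 'b::euclidean_space"
  assumes [measurable]: "F' \<in> borel_measurable borel"
  shows "radial_grad F' i \<in> borel_measurable borel"
  unfolding radial_grad_def by measurable

lemma borel_measurable_radial_hess [measurable]:
  fixes F' :: "real \<Rightarrow> 'b::euclidean_space"
  assumes [measurable]: "F' \<in> borel_measurable borel" "F'' \<in> borel_measurable borel"
  shows "radial_hess F' F'' i j \<in> borel_measurable borel"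
  unfolding radial_hess_def by measurable

lemma sum_radial_grad_sq:
  fixes x :: "real^'n::finite"
  assumes "x \<noteq> 0"
  shows "(\<Sum>i\<in>UNIV. (norm (radial_grad F' i x))\<^sup>2) = (norm (F' (ln (norm x))))\<^sup>2 / (norm x)\<^sup>2"
proof -
  have "(\<Sum>i\<in>UNIV. (norm (radial_grad F' i x))\<^sup>2)
      = (\<Sum>i\<in>UNIV. (x $ i)\<^sup>2) * ((norm (F' (ln (norm x))))\<^sup>2 / norm x ^ 4)"
    unfolding sum_distrib_right
    by (intro sum.cong) (auto simp: radial_grad_def power_mult_distrib power_divide power_mult[symmetric])
  also have "(\<Sum>i\<in>UNIV. (x $ i)\<^sup>2) = (norm x)\<^sup>2"
    by (simp add: norm_vec_def L2_set_def sum_nonneg)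
  finally show ?thesis
    using assms by (simp add: power2_eq_square power4_eq_xxxx)
qed

lemma sum_radial_hess:
  fixes x :: "real^'n::finite"
  assumes "x \<noteq> 0"
  shows "(\<Sum>i\<in>UNIV. radial_hess F' F'' i i x) =
    (F'' (ln (norm x)) + (real CARD('n) - 2) *\<^sub>R F' (ln (norm x))) /\<^sub>R (norm x)\<^sup>2"
proof -
  have sq: "(\<Sum>i\<in>UNIV. x $ i * x $ i) = (norm x)\<^sup>2"
    by (simp add: norm_vec_def L2_set_def sum_nonneg power2_eq_square)
  have "(\<Sum>i\<in>UNIV. radial_hess F' F'' i i x) =
      (real CARD('n) / (norm x)\<^sup>2 - 2 * (\<Sum>i\<in>UNIV. x $ i * x $ i) / norm x ^ 4) *\<^sub>R F' (ln (norm x))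
      + ((\<Sum>i\<in>UNIV. x $ i * x $ i) / norm x ^ 4) *\<^sub>R F'' (ln (norm x))"
    by (simp add: radial_hess_def sum.distrib scaleR_sum_left[symmetric] sum_subtractf
        sum_divide_distrib[symmetric] sum_distrib_left[symmetric])
  also have "\<dots> = (F'' (ln (norm x)) + (real CARD('n) - 2) *\<^sub>R F' (ln (norm x))) /\<^sub>R (norm x)\<^sup>2"
  proof -
    have "(norm x)\<^sup>2 / norm x ^ 4 = inverse ((norm x)\<^sup>2)"
      "real CARD('n) / (norm x)\<^sup>2 - 2 * (norm x)\<^sup>2 / norm x ^ 4 = inverse ((norm x)\<^sup>2) * (real CARD('n) - 2)"
      using assms by (simp_all add: field_simps power2_eq_square power4_eq_xxxx)
    then show ?thesis by (simp add: sq scaleR_add_right add.commute)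
  qed
  finally show ?thesis .
qed

lemma norm_radial_grad_le: "norm (radial_grad F' i x) \<le> norm (F' (ln (norm x))) / norm x"
proof (cases "x = 0")
  case False
  have "norm (radial_grad F' i x) = \<bar>x $ i\<bar> * (norm (F' (ln (norm x))) / (norm x)\<^sup>2)"
    by (simp add: radial_grad_def)
  also have "\<dots> \<le> norm x * (norm (F' (ln (norm x))) / (norm x)\<^sup>2)"
    by (intro mult_right_mono component_le_norm_cart) auto
  finally show ?thesis using False by (simp add: power2_eq_square)
qed (simp add: radial_grad_def)

lemma norm_radial_hess_le:
  "norm (radial_hess F' F'' i j x) \<le> (3 * norm (F' (ln (norm x))) + norm (F'' (ln (norm x)))) / (norm x)\<^sup>2"
proof (cases "x = 0")
  case False
  have ij: "\<bar>x $ i * x $ j\<bar> / norm x ^ 4 \<le> 1 / (norm x)\<^sup>2"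
  proof -
    have "\<bar>x $ i * x $ j\<bar> \<le> norm x * norm x"
      unfolding abs_mult by (intro mult_mono component_le_norm_cart) auto
    then show ?thesis
      using False by (simp add: field_simps power2_eq_square power4_eq_xxxx)
  qed
  have ax: "\<bar>axis j 1 $ i\<bar> / (norm x)\<^sup>2 \<le> 1 / (norm x)\<^sup>2"
    by (intro divide_right_mono) (auto simp: axis_def)
  have "\<bar>axis j 1 $ i / (norm x)\<^sup>2 - 2 * (x $ i * x $ j) / norm x ^ 4\<bar>
      \<le> \<bar>axis j 1 $ i\<bar> / (norm x)\<^sup>2 + 2 * (\<bar>x $ i * x $ j\<bar> / norm x ^ 4)"
    by (rule order_trans[OF abs_triangle_ineq4]) (simp add: abs_mult)
  also have "\<dots> \<le> 1 / (norm x)\<^sup>2 + 2 * (1 / (norm x)\<^sup>2)"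
    using ij ax by linarith
  finally have c: "\<bar>axis j 1 $ i / (norm x)\<^sup>2 - 2 * (x $ i * x $ j) / norm x ^ 4\<bar> \<le> 3 / (norm x)\<^sup>2"
    by simp
  have "norm (radial_hess F' F'' i j x) \<le> 3 / (norm x)\<^sup>2 * norm (F' (ln (norm x)))
      + 1 / (norm x)\<^sup>2 * norm (F'' (ln (norm x)))"
    unfolding radial_hess_def
    by (rule norm_triangle_le, rule add_mono; unfold norm_scaleR; rule mult_right_mono)
      (use c ij in \<open>auto simp: abs_mult\<close>)
  then show ?thesis by (simp add: add_divide_distrib)
qed (simp add: radial_hess_def)

section \<open>The critical logarithmic weight\<close>

text \<open>On the shell \<open>e\<^bsup>-k-2\<^esup> \<le> |x| \<le> e\<^bsup>-k-1\<^esup>\<close> the function is at most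
  \<open>c k = e\<^bsup>n(k+2)\<^esup> / (k+1)\<^sup>2\<close>, and the shell lies in a ball \<open>A k\<close> of volume proportional to
  \<open>e\<^bsup>-n(k+1)\<^esup>\<close>. The exponentials cancel and \<open>\<Sum> 1 / (k+1)\<^sup>2\<close> remains. In polar coordinates this
  is the convergence of the integral of \<open>1 / (r (ln r)\<^sup>2)\<close> at 0.\<close>

lemma integrable_log_weight:
  assumes "1 \<le> a"
  shows "integrable (lebesgue_on (cball (0::'a::euclidean_space) (exp (- a))))
    (\<lambda>x. 1 / (norm x ^ DIM('a) * (ln (norm x))\<^sup>2))"
proof -
  let ?n = "DIM('a)" and ?B = "cball (0::'a) (exp (- a))"
  let ?w = "\<lambda>x::'a. 1 / (norm x ^ ?n * (ln (norm x))\<^sup>2)"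
  define \<omega> where "\<omega> = measure lborel (ball (0::'a) 1)"
  define c where "c k = exp (real ?n * real (k + 2)) / (real (k + 1))\<^sup>2" for k :: nat
  define A where "A k = cball (0::'a) (exp (- real (k + 1)))" for k :: nat
  define g where "g k x = ennreal (c k) * indicator (A k) x" for k x
  have pointwise: "ennreal (norm (?w x)) \<le> (\<Sum>k. g k x)" if "x \<in> ?B" for x
  proof (cases "x = 0")
    case False
    \<comment> \<open>The shift by 1 makes the indices of the shells start at 0, as \<open>- ln |x| \<ge> 1\<close>.\<close>
    define k where "k = nat \<lfloor>- ln (norm x)\<rfloor> - 1"
    have "norm x \<le> exp (- a)" using that by simp
    then have "ln (norm x) \<le> - a"
      using False by (metis ln_exp ln_le_cancel_iff exp_gt_zero zero_less_norm_iff)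
    then have k: "real (k + 1) \<le> - ln (norm x)" "- ln (norm x) \<le> real (k + 2)"
      using assms by (auto simp: k_def of_nat_diff le_nat_iff) linarith+
    have nx: "norm x = exp (ln (norm x))" using False by simp
    have "x \<in> A k"
      using k(1) by (subst A_def, subst mem_cball, subst dist_0_norm, subst nx) simp
    have xn: "norm x ^ ?n = exp (real ?n * ln (norm x))"
      by (subst nx) (simp only: exp_of_nat_mult)
    have "norm (?w x) = exp (real ?n * - ln (norm x)) / (- ln (norm x))\<^sup>2"
      by (simp add: xn exp_minus field_simps)
    moreover have "exp (real ?n * - ln (norm x)) / (- ln (norm x))\<^sup>2 \<le> c k"
    proof -
      have "real ?n * - ln (norm x) \<le> real ?n * real (k + 2)"
        using k(2) by (rule mult_left_mono) simp
      moreover have "(real (k + 1))\<^sup>2 \<le> (- ln (norm x))\<^sup>2"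
        using k(1) by (rule power_mono) simp
      ultimately show ?thesis
        unfolding c_def by (intro frac_le) auto
    qed
    ultimately have "ennreal (norm (?w x)) \<le> g k x"
      using \<open>x \<in> A k\<close> by (simp add: g_def ennreal_leI)
    also have "\<dots> \<le> (\<Sum>k. g k x)"
      using sum_le_suminf[of "\<lambda>k. g k x" "{k}"] by (simp add: summableI)
    finally show ?thesis .
  qed simp
  have vol: "emeasure lebesgue (A k) = ennreal (\<omega> * exp (- (real ?n * real (k + 1))))" for k
  proof -
    have "measure lborel (A k) = exp (- real (k + 1)) ^ ?n * \<omega>"
      unfolding A_def \<omega>_def content_cball_conv_ball
      by (rule content_ball_conv_unit_ball) simp
    also have "exp (- real (k + 1)) ^ ?n = exp (- (real ?n * real (k + 1)))"
      by (simp add: exp_of_nat_mult[symmetric] algebra_simps)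
    finally show ?thesis
      using emeasure_eq_ennreal_measure[of lborel "A k"] emeasure_lborel_cball_finite[of "0::'a" "exp (- real (k + 1))"]
      by (simp add: A_def mult.commute)
  qed
  have summ: "summable (\<lambda>k. exp (real ?n) * \<omega> / (real (k + 1))\<^sup>2)"
  proof -
    have "summable (\<lambda>k. 1 / (real (Suc k))\<^sup>2)"
      using inverse_power_summable[of 2, where 'a = real]
      by (subst summable_Suc_iff) (simp add: inverse_eq_divide)
    from summable_mult[OF this, of "exp (real ?n) * \<omega>"] show ?thesis by simp
  qed
  have "(\<integral>\<^sup>+x. norm (?w x) \<partial>lebesgue_on ?B) = (\<integral>\<^sup>+x. ennreal (norm (?w x)) * indicator ?B x \<partial>lebesgue)"
    by (rule nn_integral_restrict_space) simp
  also have "\<dots> \<le> (\<integral>\<^sup>+x. (\<Sum>k. g k x) \<partial>lebesgue)"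
    by (rule nn_integral_mono) (use pointwise in \<open>simp add: indicator_def del: mem_cball\<close>)
  also have "\<dots> = (\<Sum>k. \<integral>\<^sup>+x. g k x \<partial>lebesgue)"
    unfolding g_def
    by (intro nn_integral_suminf borel_measurable_times_ennreal borel_measurable_indicator borel_measurable_const)
      (simp add: A_def)
  also have "\<dots> = (\<Sum>k. ennreal (exp (real ?n) * \<omega> / (real (k + 1))\<^sup>2))"
  proof (rule suminf_cong)
    fix k
    have "(\<integral>\<^sup>+x. g k x \<partial>lebesgue) = ennreal (c k) * emeasure lebesgue (A k)"
      unfolding g_def by (rule nn_integral_cmult_indicator) (auto simp: A_def)
    also have "\<dots> = ennreal (c k * (\<omega> * exp (- (real ?n * real (k + 1)))))"
      unfolding vol by (rule ennreal_mult''[symmetric]) (simp add: \<omega>_def)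
    also have "c k * (\<omega> * exp (- (real ?n * real (k + 1)))) =
        exp (real ?n * real (k + 2) - real ?n * real (k + 1)) * \<omega> / (real (k + 1))\<^sup>2"
      by (simp only: c_def exp_diff exp_minus divide_inverse mult_ac)
    also have "real ?n * real (k + 2) - real ?n * real (k + 1) = real ?n"
      by (simp add: algebra_simps)
    finally show "(\<integral>\<^sup>+x. g k x \<partial>lebesgue) = ennreal (exp (real ?n) * \<omega> / (real (k + 1))\<^sup>2)" .
  qed
  also have "\<dots> = ennreal (\<Sum>k. exp (real ?n) * \<omega> / (real (k + 1))\<^sup>2)"
    by (rule suminf_ennreal2[OF _ summ]) (simp add: \<omega>_def)
  also have "\<dots> < \<infinity>"
    by simp
  finally have "(\<integral>\<^sup>+x. norm (?w x) \<partial>lebesgue_on ?B) < \<infinity>" .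
  moreover have "?w \<in> borel_measurable borel"
    by measurable
  then have "?w \<in> borel_measurable (lebesgue_on ?B)"
    by (intro measurable_restrict_space1 measurable_completion) simp
  ultimately show ?thesis
    by (intro integrableI_bounded)
qed

section \<open>Weak derivatives across the origin\<close>

lemma AE_lebesgue_on_nonzero: "AE x in lebesgue_on \<Omega>. x \<noteq> (0::'a::euclidean_space)" if "\<Omega> \<in> sets lebesgue"
  using that by (subst AE_restrict_space_iff) (auto intro: AE_mp[OF AE_not_in[of "{0}"]])

text \<open>The map under study has an arbitrary value at 0. Since a point is a null set, neither
  measurability nor integrability depends on that value.\<close>

lemma borel_measurable_off_0:
  fixes f g :: "'a::euclidean_space \<Rightarrow> 'b::euclidean_space"
  assumes g: "g \<in> borel_measurable borel" and eq: "\<And>x. x \<in> \<Omega> \<Longrightarrow> x \<noteq> 0 \<Longrightarrow> f x = g x"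
  shows "f \<in> borel_measurable (lebesgue_on \<Omega>)"
proof -
  have "(\<lambda>x. if x = 0 then f 0 else g x) \<in> borel_measurable borel"
    using g by measurable
  then have "(\<lambda>x. if x = 0 then f 0 else g x) \<in> borel_measurable (lebesgue_on \<Omega>)"
    by (intro measurable_restrict_space1 measurable_completion) simp
  then show ?thesis
    by (rule measurable_cong[THEN iffD1, rotated]) (use eq in \<open>auto simp: space_restrict_space\<close>)
qed

lemma integrable_dominated_off_0:
  fixes f :: "'a::euclidean_space \<Rightarrow> 'b::euclidean_space"
  assumes "\<Omega> \<in> sets lebesgue" "f \<in> borel_measurable (lebesgue_on \<Omega>)" "integrable (lebesgue_on \<Omega>) w"
    and bound: "\<And>x. x \<in> \<Omega> \<Longrightarrow> x \<noteq> 0 \<Longrightarrow> norm (f x) \<le> C * w x"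
  shows "integrable (lebesgue_on \<Omega>) f"
proof (rule Bochner_Integration.integrable_bound)
  show "integrable (lebesgue_on \<Omega>) (\<lambda>x. C * w x)" using assms by simp
  show "AE x in lebesgue_on \<Omega>. norm (f x) \<le> norm (C * w x)"
    using AE_lebesgue_on_nonzero[OF assms(1)] AE_space
  proof eventually_elim
    case (elim x)
    then show ?case using bound[of x] by (simp add: space_restrict_space)
  qed
qed fact

lemma integrable_imp_L1_loc:
  fixes f :: "real^'n::finite \<Rightarrow> 'b::euclidean_space"
  assumes "\<Omega> \<in> sets lebesgue" "integrable (lebesgue_on \<Omega>) f"
  shows "L1_loc \<Omega> f"
  unfolding L1_loc_def
proof (intro allI impI)
  fix K :: "(real^'n) set" assume K: "compact K \<and> K \<subseteq> interior \<Omega>"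
  have "integrable lebesgue (\<lambda>x. indicator \<Omega> x *\<^sub>R f x)"
    using assms by (simp add: integrable_restrict_space)
  then have "integrable lebesgue (\<lambda>x. indicator K x *\<^sub>R indicator \<Omega> x *\<^sub>R f x)"
    using K by (intro integrable_mult_indicator[where A = K]) (auto simp: lmeasurable_compact fmeasurableD)
  moreover have "(\<lambda>x. indicator K x *\<^sub>R indicator \<Omega> x *\<^sub>R f x) = (\<lambda>x. indicator K x *\<^sub>R f x)"
    using K interior_subset[of \<Omega>] by (auto simp: indicator_def fun_eq_iff)
  ultimately show "f absolutely_integrable_on K"
    by (simp add: set_integrable_def)
qed

lemma test_function_partial_deriv:
  assumes "test_function \<Omega> \<phi>"
  shows "test_function \<Omega> (partial_deriv i \<phi>)"
proof -
  have "C_k (Suc k) \<phi>" for k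
    using assms unfolding test_function_def smooth_def by blast
  then have "smooth (partial_deriv i \<phi>)"
    by (simp add: smooth_def)
  moreover have "closure {x. partial_deriv i \<phi> x \<noteq> 0} \<subseteq> closure {x. \<phi> x \<noteq> 0}"
  proof (rule closure_minimal)
    have "\<phi> x = 0" if "x \<notin> closure {x. \<phi> x \<noteq> 0}" for x
      using that closure_subset[of "{x. \<phi> x \<noteq> 0}"] by blast
    from partial_deriv_eq_0_outside[where f = \<phi>, OF closed_closure this]
    show "{x. partial_deriv i \<phi> x \<noteq> 0} \<subseteq> closure {x. \<phi> x \<noteq> 0}"
      by blast
  qed simp
  ultimately show ?thesis
    using assms compact_Int_closed[of "closure {x. \<phi> x \<noteq> 0}" "closure {x. partial_deriv i \<phi> x \<noteq> 0}"]
    by (auto simp: test_function_def Int_absorb1)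
qed

lemma test_function_C1:
  assumes "test_function \<Omega> \<phi>"
  obtains K where "C_k (Suc 0) \<phi>" "compact K" "K \<subseteq> interior \<Omega>" "\<And>x. x \<notin> K \<Longrightarrow> \<phi> x = 0"
proof (rule that[of "closure {x. \<phi> x \<noteq> 0}"])
  show "\<phi> x = 0" if "x \<notin> closure {x. \<phi> x \<noteq> 0}" for x
    using that closure_subset[of "{x. \<phi> x \<noteq> 0}"] by blast
qed (use assms in \<open>auto simp: test_function_def smooth_def simp del: C_k.simps\<close>)

lemma integrable_test_function_bilinear:
  fixes prod :: "'a::euclidean_space \<Rightarrow> 'b::euclidean_space \<Rightarrow> 'c::euclidean_space"
    and \<phi> :: "real^'n::finite \<Rightarrow> 'a"
  assumes bil: "bounded_bilinear prod" and \<Omega>: "\<Omega> \<in> sets lebesgue" and \<phi>: "test_function \<Omega> \<phi>"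
    and v: "integrable (lebesgue_on \<Omega>) v"
  shows "integrable (lebesgue_on \<Omega>) (\<lambda>x. prod (\<phi> x) (v x))"
proof -
  obtain K where K: "C_k (Suc 0) \<phi>" "compact K" "\<And>x. x \<notin> K \<Longrightarrow> \<phi> x = 0"
    using test_function_C1[OF \<phi>] by metis
  have cont: "continuous_on A \<phi>" for A
    using continuous_on_C1[OF K(1)] by (rule continuous_on_subset) simp
  obtain C where "\<And>x. norm (\<phi> x) \<le> C"
    using bounded_compact_support[OF cont K(2,3)] by blast
  then show ?thesis
    by (rule integrable_bounded_bilinear[OF bil continuous_imp_measurable_on_sets_lebesgue[OF cont \<Omega>] _ v])
qed

text \<open>The case of a vector field with a single nonzero component.\<close>

lemma integration_by_parts_punctured_partial:
  fixes prod :: "'a::euclidean_space \<Rightarrow> 'b::euclidean_space \<Rightarrow> 'c::euclidean_space"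
    and \<phi> :: "real^'n::finite \<Rightarrow> 'a"
  assumes bil: "bounded_bilinear prod" and \<Omega>: "\<Omega> \<in> sets lebesgue" and \<phi>: "test_function \<Omega> \<phi>"
    and v: "\<And>x. x \<in> interior \<Omega> - {0} \<Longrightarrow> v differentiable (at x)"
    and g: "\<And>x. x \<in> interior \<Omega> - {0} \<Longrightarrow> partial_deriv i v x = g x"
    and cont: "continuous_on (interior \<Omega> - {0}) g"
    and int: "integrable (lebesgue_on \<Omega>) v" "integrable (lebesgue_on \<Omega>) g"
    and decay: "((\<lambda>x. norm x ^ (CARD('n) - 1) *\<^sub>R v x) \<longlongrightarrow> 0) (at 0)"
  shows "integral\<^sup>L (lebesgue_on \<Omega>) (\<lambda>x. prod (partial_deriv i \<phi> x) (v x))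
    = - integral\<^sup>L (lebesgue_on \<Omega>) (\<lambda>x. prod (\<phi> x) (g x))"
proof -
  interpret bounded_bilinear prod by (rule bil)
  obtain K where K: "C_k (Suc 0) \<phi>" "compact K" "K \<subseteq> interior \<Omega>" "\<And>x. x \<notin> K \<Longrightarrow> \<phi> x = 0"
    using test_function_C1[OF \<phi>] by metis
  define V where "V j = (if j = i then v else (\<lambda>_. 0))" for j
  have pdV: "partial_deriv j (V j) x = (if j = i then g x else 0)" if "x \<in> interior \<Omega> - {0}" for j x
    using g[OF that] by (auto simp: V_def)
  have "integral\<^sup>L (lebesgue_on \<Omega>) (\<lambda>x. \<Sum>j\<in>UNIV. prod (partial_deriv j \<phi> x) (V j x))
    = - integral\<^sup>L (lebesgue_on \<Omega>) (\<lambda>x. prod (\<phi> x) (g x))"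
  proof (rule integration_by_parts_punctured[OF bil \<Omega> K])
    show "continuous_on (interior \<Omega> - {0}) (partial_deriv j (V j))" for j
      using cont by (cases "j = i"; subst continuous_on_cong[OF refl pdV]) auto
  qed (use v int decay pdV in \<open>auto simp: V_def\<close>)
  moreover have "(\<Sum>j\<in>UNIV. prod (partial_deriv j \<phi> x) (V j x)) = prod (partial_deriv i \<phi> x) (v x)" for x
  proof -
    have "(\<Sum>j\<in>UNIV. prod (partial_deriv j \<phi> x) (V j x))
        = (\<Sum>j\<in>UNIV. if j = i then prod (partial_deriv i \<phi> x) (v x) else 0)"
      by (intro sum.cong) (auto simp: V_def zero_right)
    then show ?thesis by simp
  qed
  ultimately show ?thesis by simp
qed

lemma weak_partial_punctured:
  fixes v :: "real^'n::finite \<Rightarrow> 'b::euclidean_space"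
  assumes "\<Omega> \<in> sets lebesgue"
    and "\<And>x. x \<in> interior \<Omega> - {0} \<Longrightarrow> v differentiable (at x)"
    and "\<And>x. x \<in> interior \<Omega> - {0} \<Longrightarrow> partial_deriv i v x = g x"
    and "continuous_on (interior \<Omega> - {0}) g"
    and "integrable (lebesgue_on \<Omega>) v" "integrable (lebesgue_on \<Omega>) g"
    and "((\<lambda>x. norm x ^ (CARD('n) - 1) *\<^sub>R v x) \<longlongrightarrow> 0) (at 0)"
  shows "weak_partial \<Omega> i v g"
  unfolding weak_partial_def
proof (intro conjI allI impI)
  fix \<phi> :: "real^'n \<Rightarrow> real" assume \<phi>: "test_function \<Omega> \<phi>"
  show "integral\<^sup>L (lebesgue_on \<Omega>) (\<lambda>x. partial_deriv i \<phi> x *\<^sub>R v x)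
      = - integral\<^sup>L (lebesgue_on \<Omega>) (\<lambda>x. \<phi> x *\<^sub>R g x)"
    by (rule integration_by_parts_punctured_partial[OF bounded_bilinear_scaleR assms(1) \<phi> assms(2-)])
qed (intro integrable_imp_L1_loc assms)+

text \<open>Two integrations by parts across 0 move the Laplacian onto \<open>w\<close> one derivative at a time.
  The first is done separately in each direction, which the integrability of every \<open>V i\<close>
  permits. The second treats \<open>V\<close> as a vector field, because only its divergence is
  assumed integrable.\<close>

lemma weak_bilaplacian_punctured:
  fixes w g :: "real^'n::finite \<Rightarrow> 'b::euclidean_space"
  assumes \<Omega>: "\<Omega> \<in> sets lebesgue" and \<phi>: "test_function \<Omega> \<phi>"
    and w: "\<And>x. x \<in> interior \<Omega> - {0} \<Longrightarrow> w differentiable (at x)"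
    and V: "\<And>i x. x \<in> interior \<Omega> - {0} \<Longrightarrow> partial_deriv i w x = V i x"
    and V': "\<And>i x. x \<in> interior \<Omega> - {0} \<Longrightarrow> V i differentiable (at x)"
    and cont: "\<And>i. continuous_on (interior \<Omega> - {0}) (partial_deriv i (V i))"
    and g: "\<And>x. x \<in> interior \<Omega> - {0} \<Longrightarrow> g x = (\<Sum>i\<in>UNIV. partial_deriv i (V i) x)"
    and int: "integrable (lebesgue_on \<Omega>) w" "\<And>i. integrable (lebesgue_on \<Omega>) (V i)" "integrable (lebesgue_on \<Omega>) g"
    and decay: "((\<lambda>x. norm x ^ (CARD('n) - 1) *\<^sub>R w x) \<longlongrightarrow> 0) (at 0)"
      "\<And>i. ((\<lambda>x. norm x ^ (CARD('n) - 1) *\<^sub>R V i x) \<longlongrightarrow> 0) (at 0)"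
  shows "integral\<^sup>L (lebesgue_on \<Omega>) (\<lambda>x. w x \<bullet> laplacian \<phi> x) = integral\<^sup>L (lebesgue_on \<Omega>) (\<lambda>x. g x \<bullet> \<phi> x)"
proof -
  note bil = bounded_bilinear_inner[where 'a = 'b] and test = test_function_partial_deriv[OF \<phi>]
  have contV: "continuous_on (interior \<Omega> - {0}) (V i)" for i
    using V'[of _ i] open_delete[OF open_interior[of \<Omega>], of 0]
    by (auto simp: continuous_on_eq_continuous_at intro: differentiable_imp_continuous_within)
  have "integral\<^sup>L (lebesgue_on \<Omega>) (\<lambda>x. w x \<bullet> laplacian \<phi> x)
      = integral\<^sup>L (lebesgue_on \<Omega>) (\<lambda>x. \<Sum>i\<in>UNIV. partial_deriv i (partial_deriv i \<phi>) x \<bullet> w x)"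
    by (simp add: laplacian_def inner_sum_right inner_commute)
  also have "\<dots> = (\<Sum>i\<in>UNIV. integral\<^sup>L (lebesgue_on \<Omega>) (\<lambda>x. partial_deriv i (partial_deriv i \<phi>) x \<bullet> w x))"
    by (rule Bochner_Integration.integral_sum)
      (rule integrable_test_function_bilinear[OF bil \<Omega> test_function_partial_deriv[OF test] int(1)])
  also have "\<dots> = (\<Sum>i\<in>UNIV. - integral\<^sup>L (lebesgue_on \<Omega>) (\<lambda>x. partial_deriv i \<phi> x \<bullet> V i x))"
    by (intro sum.cong refl integration_by_parts_punctured_partial[OF bil \<Omega> test w V contV int(1,2) decay(1)]) auto
  also have "\<dots> = - integral\<^sup>L (lebesgue_on \<Omega>) (\<lambda>x. \<Sum>i\<in>UNIV. partial_deriv i \<phi> x \<bullet> V i x)"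
    by (subst Bochner_Integration.integral_sum)
      (auto intro: integrable_test_function_bilinear[OF bil \<Omega> test int(2)] simp: sum_negf)
  also have "integral\<^sup>L (lebesgue_on \<Omega>) (\<lambda>x. \<Sum>i\<in>UNIV. partial_deriv i \<phi> x \<bullet> V i x)
      = - integral\<^sup>L (lebesgue_on \<Omega>) (\<lambda>x. \<phi> x \<bullet> g x)"
  proof -
    obtain K where K: "C_k (Suc 0) \<phi>" "compact K" "K \<subseteq> interior \<Omega>" "\<And>x. x \<notin> K \<Longrightarrow> \<phi> x = 0"
      using test_function_C1[OF \<phi>] by metis
    show ?thesis
      by (rule integration_by_parts_punctured[OF bil \<Omega> K V' cont g int(2,3) decay(2)])
  qed
  finally show ?thesis by (simp add: inner_commute)
qed

section \<open>The map as a complex power of the logarithm\<close>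

text \<open>The components of the map are \<open>sin \<theta>\<close> and \<open>cos \<theta>\<close>, in this order, so the imaginary part of
  \<open>e\<^bsup>i\<theta>\<^esup>\<close> comes first.\<close>

definition to_R2 :: "complex \<Rightarrow> real^2" where
  "to_R2 z = vector [Im z, Re z]"

text \<open>With \<open>L = - s\<close>, this is the vector of \<open>c L\<^bsup>-k\<^esup> e\<^bsup>i ln L\<^esup> = c L\<^bsup>i-k\<^esup>\<close>. Differentiation in
  \<open>s\<close> multiplies \<open>c\<close> by \<open>k - i\<close> and increases \<open>k\<close> by 1, so the family contains all derivatives
  of the map \<open>wave 1 0\<close> that the theorem is about.\<close>

definition wave :: "complex \<Rightarrow> nat \<Rightarrow> real \<Rightarrow> real^2" where
  "wave c k s = to_R2 (c * exp ((\<i> - of_nat k) * of_real (ln (- s))))"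

lemma bounded_linear_to_R2: "bounded_linear to_R2"
  unfolding linear_conv_bounded_linear[symmetric]
  by (rule linearI) (simp_all add: to_R2_def vec_eq_iff forall_2)

lemma norm_to_R2: "norm (to_R2 z) = cmod z"
  by (simp add: to_R2_def norm_vec_def L2_set_def sum_2 cmod_def add.commute)

lemma wave_nth:
  assumes "s < 0"
  shows "wave c k s $ 1 = (Re c * sin (ln (- s)) + Im c * cos (ln (- s))) / (- s) ^ k"
    and "wave c k s $ 2 = (Re c * cos (ln (- s)) - Im c * sin (ln (- s))) / (- s) ^ k"
proof -
  have "exp (- (real k * ln (- s))) = 1 / (- s) ^ k"
    using assms by (simp add: exp_minus exp_of_nat_mult divide_inverse)
  then have "exp ((\<i> - of_nat k) * of_real (ln (- s))) = cis (ln (- s)) /\<^sub>R (- s) ^ k"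
    by (simp add: complex_eq_iff Re_exp Im_exp divide_inverse mult.commute)
  then show "wave c k s $ 1 = (Re c * sin (ln (- s)) + Im c * cos (ln (- s))) / (- s) ^ k"
    "wave c k s $ 2 = (Re c * cos (ln (- s)) - Im c * sin (ln (- s))) / (- s) ^ k"
    by (simp_all add: wave_def to_R2_def divide_inverse algebra_simps)
qed

lemma norm_wave:
  assumes "s < 0"
  shows "norm (wave c k s) = cmod c / (- s) ^ k"
proof -
  have "norm (wave c k s) = cmod c * exp (- (real k * ln (- s)))"
    by (simp add: wave_def norm_to_R2 norm_mult)
  then show ?thesis
    using assms by (simp add: exp_minus exp_of_nat_mult divide_inverse)
qed

lemma has_vector_derivative_wave:
  assumes "s < 0"
  shows "(wave c k has_vector_derivative wave (c * (of_nat k - \<i>)) (Suc k) s) (at s)"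
proof -
  let ?l = "complex_of_real (ln (- s))"
  have l: "((\<lambda>s. of_real (ln (- s))) has_vector_derivative complex_of_real (1 / s)) (at s)"
    using assms
    by (intro has_vector_derivative_of_real) (auto intro!: derivative_eq_intros)
  have e: "((\<lambda>z. c * exp ((\<i> - of_nat k) * z)) has_field_derivative
      c * (exp ((\<i> - of_nat k) * ?l) * (\<i> - of_nat k))) (at ?l)"
    by (auto intro!: derivative_eq_intros)
  define d E where "d = complex_of_real (1 / s)" and "E = exp ((\<i> - of_nat k) * ?l)"
  have "exp (- ln (- s)) = - (1 / s)"
    using assms by (simp add: exp_minus inverse_eq_divide)
  then have "exp (- ?l) = - d"
    by (metis d_def exp_of_real of_real_minus)
  moreover have "(\<i> - of_nat (Suc k)) * ?l = (\<i> - of_nat k) * ?l + - ?l"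
    by (simp add: algebra_simps)
  ultimately have "exp ((\<i> - of_nat (Suc k)) * ?l) = E * - d"
    unfolding E_def by (metis exp_add)
  then have eq: "d * (c * (E * (\<i> - of_nat k)))
      = c * (of_nat k - \<i>) * exp ((\<i> - of_nat (Suc k)) * ?l)"
    by (simp add: algebra_simps)
  from bounded_linear.has_vector_derivative[OF bounded_linear_to_R2 field_vector_diff_chain_at[OF l e]]
  show ?thesis
    unfolding eq[unfolded d_def E_def] by (simp add: wave_def[abs_def] o_def)
qed

lemma borel_measurable_wave [measurable]: "wave c k \<in> borel_measurable borel"
proof -
  have "to_R2 \<in> borel_measurable borel"
    by (intro borel_measurable_continuous_onI linear_continuous_on bounded_linear_to_R2)
  then show ?thesis
    unfolding wave_def by measurable
qed

lemma continuous_on_wave: "continuous_on {..<0} (wave c k)"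
  by (intro continuous_at_imp_continuous_on ballI has_vector_derivative_continuous[OF has_vector_derivative_wave]) simp

text \<open>In dimension four \<open>lap_profile\<close> is the Laplacian of \<open>wave 1 0 (ln |x|)\<close> as a function of
  \<open>s = ln |x|\<close>; the other two are its derivatives. In the formula \<open>e\<^bsup>-2s\<^esup> (F'' + 2 F')\<close> for the
  Laplacian, applied a second time, with \<open>D = d/ds\<close>, the terms of odd order cancel and
  \<open>e\<^bsup>-4s\<^esup> (D\<^sup>4 F - 4 D\<^sup>2 F)\<close> is left.\<close>

definition lap_profile :: "real \<Rightarrow> real^2" where
  "lap_profile s = exp (- 2 * s) *\<^sub>R (wave (-1 - \<i>) 2 s + 2 *\<^sub>R wave (- \<i>) 1 s)"

definition lap_profile' :: "real \<Rightarrow> real^2" where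
  "lap_profile' s = exp (- 2 * s) *\<^sub>R (wave (-3 - \<i>) 3 s - 4 *\<^sub>R wave (- \<i>) 1 s)"

definition lap_profile'' :: "real \<Rightarrow> real^2" where
  "lap_profile'' s = exp (- 2 * s) *\<^sub>R (wave (-10) 4 s - 4 *\<^sub>R wave (-1 - \<i>) 2 s) - 2 *\<^sub>R lap_profile' s"

lemma has_vector_derivative_wave_iterates:
  assumes "s < 0"
  shows "(wave 1 0 has_vector_derivative wave (- \<i>) 1 s) (at s)"
    and "(wave (- \<i>) 1 has_vector_derivative wave (-1 - \<i>) 2 s) (at s)"
    and "(wave (-1 - \<i>) 2 has_vector_derivative wave (-3 - \<i>) 3 s) (at s)"
    and "(wave (-3 - \<i>) 3 has_vector_derivative wave (-10) 4 s) (at s)"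
proof -
  have c: "1 * (of_nat 0 - \<i>) = - \<i>" "- \<i> * (of_nat 1 - \<i>) = -1 - \<i>"
    "(-1 - \<i>) * (of_nat 2 - \<i>) = -3 - \<i>" "(-3 - \<i>) * (of_nat 3 - \<i>) = -10"
    by (simp_all add: complex_eq_iff)
  have n: "Suc 0 = 1" "Suc 1 = 2" "Suc 2 = 3" "Suc 3 = 4"
    by simp_all
  note d = has_vector_derivative_wave[OF assms]
  show "(wave 1 0 has_vector_derivative wave (- \<i>) 1 s) (at s)"
    using d[of 1 0] unfolding c n .
  show "(wave (- \<i>) 1 has_vector_derivative wave (-1 - \<i>) 2 s) (at s)"
    using d[of "- \<i>" 1] unfolding c n .
  show "(wave (-1 - \<i>) 2 has_vector_derivative wave (-3 - \<i>) 3 s) (at s)"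
    using d[of "-1 - \<i>" 2] unfolding c n .
  show "(wave (-3 - \<i>) 3 has_vector_derivative wave (-10) 4 s) (at s)"
    using d[of "-3 - \<i>" 3] unfolding c n .
qed

lemma has_vector_derivative_exp_scaleR:
  fixes f :: "real \<Rightarrow> 'a::real_normed_vector"
  assumes "(f has_vector_derivative f') (at s)"
  shows "((\<lambda>s. exp (- 2 * s) *\<^sub>R f s) has_vector_derivative exp (- 2 * s) *\<^sub>R (f' - 2 *\<^sub>R f s)) (at s)"
proof -
  have "((\<lambda>s. exp (- 2 * s)) has_field_derivative - 2 * exp (- 2 * s)) (at s)"
    by (auto intro!: derivative_eq_intros)
  from has_vector_derivative_scaleR[OF this assms] show ?thesis
    by (simp add: algebra_simps)
qed

lemma has_vector_derivative_lap_profile: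
  assumes "s < 0"
  shows "(lap_profile has_vector_derivative lap_profile' s) (at s)"
    and "(lap_profile' has_vector_derivative lap_profile'' s) (at s)"
proof -
  note d = has_vector_derivative_wave_iterates[OF assms]
  have "((\<lambda>s. wave (-1 - \<i>) 2 s + 2 *\<^sub>R wave (- \<i>) 1 s) has_vector_derivative
      wave (-3 - \<i>) 3 s + 2 *\<^sub>R wave (-1 - \<i>) 2 s) (at s)"
    by (intro has_vector_derivative_add d bounded_linear.has_vector_derivative[OF bounded_linear_scaleR_right])
  from has_vector_derivative_exp_scaleR[OF this]
  show "(lap_profile has_vector_derivative lap_profile' s) (at s)"
    unfolding lap_profile_def[abs_def] lap_profile'_def by (simp add: algebra_simps)
  have "((\<lambda>s. wave (-3 - \<i>) 3 s - 4 *\<^sub>R wave (- \<i>) 1 s) has_vector_derivative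
      wave (-10) 4 s - 4 *\<^sub>R wave (-1 - \<i>) 2 s) (at s)"
    by (intro has_vector_derivative_diff d bounded_linear.has_vector_derivative[OF bounded_linear_scaleR_right])
  from has_vector_derivative_exp_scaleR[OF this]
  show "(lap_profile' has_vector_derivative lap_profile'' s) (at s)"
    unfolding lap_profile'_def[abs_def] lap_profile''_def by (simp add: algebra_simps)
qed

lemma cmod_coeffs: "cmod (-1 - \<i>) \<le> 2" "cmod (-3 - \<i>) \<le> 4"
  using norm_triangle_ineq4[of "-1" \<i>] norm_triangle_ineq4[of "-3" \<i>] by simp_all

lemma exp_m2_ln: "r > 0 \<Longrightarrow> exp (- (2 * ln r)) = inverse (r\<^sup>2)" for r :: real
  by (simp add: exp_minus exp_double)

lemma lap_wave_eq:
  fixes x :: "real^4"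
  assumes "x \<noteq> 0"
  shows "(\<Sum>i\<in>UNIV. radial_hess (wave (- \<i>) 1) (wave (-1 - \<i>) 2) i i x) = lap_profile (ln (norm x))"
  using assms by (simp add: sum_radial_hess lap_profile_def exp_m2_ln divide_inverse)

text \<open>The bilaplacian of the map, that is \<open>|x|\<^bsup>-4\<^esup> (D\<^sup>4 F - 4 D\<^sup>2 F)\<close> for \<open>F = wave 1 0\<close> and
  \<open>D = d/ds\<close>.\<close>

definition bilap :: "real^4 \<Rightarrow> real^2" where
  "bilap x = (wave (-10) 4 (ln (norm x)) - 4 *\<^sub>R wave (-1 - \<i>) 2 (ln (norm x))) /\<^sub>R norm x ^ 4"

lemma lap_lap_profile_eq:
  fixes x :: "real^4"
  assumes "x \<noteq> 0"
  shows "(\<Sum>i\<in>UNIV. radial_hess lap_profile' lap_profile'' i i x) = bilap x"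
proof -
  have "(\<Sum>i\<in>UNIV. radial_hess lap_profile' lap_profile'' i i x) =
     (lap_profile'' (ln (norm x)) + 2 *\<^sub>R lap_profile' (ln (norm x))) /\<^sub>R (norm x)\<^sup>2"
    using assms by (simp add: sum_radial_hess)
  also have "\<dots> = bilap x"
    using assms by (simp add: lap_profile''_def exp_m2_ln bilap_def divide_inverse power2_eq_square power4_eq_xxxx)
  finally show ?thesis .
qed

lemma continuous_on_profiles:
  "continuous_on {..<0} lap_profile'" "continuous_on {..<0} lap_profile''"
  unfolding lap_profile''_def[abs_def] lap_profile'_def[abs_def]
  by (intro continuous_intros continuous_on_wave)+

lemma borel_measurable_profiles [measurable]:
  "lap_profile' \<in> borel_measurable borel" "lap_profile \<in> borel_measurable borel"
  "bilap \<in> borel_measurable borel"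
  unfolding lap_profile'_def[abs_def] lap_profile_def[abs_def] bilap_def[abs_def] by measurable

text \<open>With \<open>S = sin (ln L)\<close>, \<open>C = cos (ln L)\<close>, \<open>r = |x|\<close> the terms of order \<open>1 / (r\<^sup>2 L\<^sup>2)\<close>
  cancel in \<open>R\<^sub>1\<close> and \<open>R\<^sub>2\<close>, and \<open>R\<^sub>1\<^sup>2 + R\<^sub>2\<^sup>2 = 4 / (r\<^sup>4 L\<^sup>2)\<close>. The first summand of the
  right-hand side then reproduces \<open>- 4 D\<^sup>2 F\<close>, with \<open>D\<close> and \<open>F\<close> as above, since multiplication
  by \<open>1 + i\<close> maps \<open>(S, C)\<close> to \<open>(S + C, C - S)\<close>; the second one, with \<open>|\<nabla>u|\<^sup>4 = 1 / (r\<^sup>4 L\<^sup>4)\<close>,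
  reproduces \<open>D\<^sup>4 F = - 10 L\<^bsup>-4\<^esup> e\<^bsup>i ln L\<^esup>\<close>.\<close>

lemma system_rhs_wave:
  fixes x :: "real^4"
  assumes "x \<noteq> 0" "ln (norm x) < 0"
  shows "system_rhs (wave 1 0 (ln (norm x)))
      (\<Sum>i\<in>UNIV. (norm (radial_grad (wave (- \<i>) 1) i x))\<^sup>2)
      (\<Sum>i\<in>UNIV. radial_hess (wave (- \<i>) 1) (wave (-1 - \<i>) 2) i i x) = bilap x"
proof -
  define r L S C where "r = norm x" and "L = - ln r" and "S = sin (ln L)" and "C = cos (ln L)"
  have pos: "r > 0" "L > 0" and s: "ln r = - L"
    using assms by (simp_all add: r_def L_def)
  have neg: "- L < 0" using pos by simp
  have SC: "S\<^sup>2 + C\<^sup>2 = 1" by (simp add: S_def C_def)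
  note defs = r_def[symmetric] s wave_nth[OF neg] norm_wave[OF neg] S_def[symmetric] C_def[symmetric]
  let ?u = "wave 1 0 (ln (norm x))"
  let ?e = "\<Sum>i\<in>UNIV. (norm (radial_grad (wave (- \<i>) 1) i x))\<^sup>2"
  let ?l = "\<Sum>i\<in>UNIV. radial_hess (wave (- \<i>) 1) (wave (-1 - \<i>) 2) i i x"
  have u: "?u $ 1 = S" "?u $ 2 = C" "norm ?u = 1"
    by (simp_all add: defs)
  have e: "?e = 1 / (r\<^sup>2 * L\<^sup>2)"
    using assms by (simp add: sum_radial_grad_sq defs power_divide)
  have l: "?l $ 1 = (- (S + C) / L\<^sup>2 - 2 * C / L) / r\<^sup>2" "?l $ 2 = ((S - C) / L\<^sup>2 + 2 * S / L) / r\<^sup>2"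
    using assms by (simp_all add: sum_radial_hess defs divide_inverse algebra_simps)
  have R: "R1 ?u ?e ?l = - 2 * C / (L * r\<^sup>2)" "R2 ?u ?e ?l = 2 * S / (L * r\<^sup>2)"
    unfolding R1_def R2_def l u e using pos by (simp_all add: field_simps)
  have "(R1 ?u ?e ?l)\<^sup>2 + (R2 ?u ?e ?l)\<^sup>2 = 4 * (S\<^sup>2 + C\<^sup>2) / (L\<^sup>2 * r ^ 4)"
    unfolding R by (simp add: power_divide power_mult_distrib power_mult[symmetric] add_divide_distrib)
  then have RR: "(R1 ?u ?e ?l)\<^sup>2 + (R2 ?u ?e ?l)\<^sup>2 = 4 / (L\<^sup>2 * r ^ 4)"
    by (simp add: SC)
  have b: "bilap x $ 1 = (- 10 * S / L ^ 4 + 4 * (S + C) / L\<^sup>2) / r ^ 4"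
    "bilap x $ 2 = (- 10 * C / L ^ 4 + 4 * (C - S) / L\<^sup>2) / r ^ 4"
    by (simp_all add: bilap_def defs divide_inverse algebra_simps)
  show ?thesis
    unfolding vec_eq_iff forall_2 system_rhs_def vector_2 RR
    unfolding b u e
    by (simp add: power_divide power_mult_distrib power_mult[symmetric] add_divide_distrib
        diff_divide_distrib algebra_simps)
qed

text \<open>The inequality \<open>|x| L \<le> 1\<close> is \<open>ln y \<le> y\<close> for \<open>y = 1 / |x|\<close>. It lets powers of \<open>|x|\<close> pay
  for powers of \<open>L\<close>.\<close>

lemma radial_bounds:
  fixes x :: "real^4"
  assumes "x \<noteq> 0" "norm x \<le> exp (- 2)"
  defines "L \<equiv> - ln (norm x)"
  shows "2 \<le> L" and "norm x * L \<le> 1" and "norm x \<le> 1"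
proof -
  have "ln (norm x) \<le> - 2"
    using assms(1,2) by (metis exp_le_cancel_iff exp_ln zero_less_norm_iff)
  then show "2 \<le> L" by (simp add: L_def)
  have "ln (inverse (norm x)) \<le> inverse (norm x) - 1"
    using assms(1) by (intro ln_le_minus_one) simp
  then have "L \<le> inverse (norm x)"
    using assms(1) by (simp add: L_def ln_inverse)
  then show "norm x * L \<le> 1"
    using assms(1) by (simp add: field_simps)
  show "norm x \<le> 1"
    using assms(2) by (rule order_trans) simp
qed

section \<open>Estimates near the origin\<close>

abbreviation small_ball :: "(real^4) set" where
  "small_ball \<equiv> cball 0 (exp (- 2))"

text \<open>All functions that occur are compared with this increasing chain of weights. Its last
  member is the integrable one; its second to last has the decay \<open>o(|x|\<^bsup>-3\<^esup>)\<close> needed for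
  integration by parts across 0; the square of \<open>1 / (|x|\<^sup>2 L)\<close> is the last one again, which
  gives square integrability.\<close>

lemma weight_le:
  fixes x :: "real^4"
  assumes "x \<noteq> 0" "norm x \<le> exp (- 2)"
  defines "L \<equiv> - ln (norm x)"
  shows "1 \<le> 1 / (norm x * L)"
    and "1 / (norm x * L) \<le> 1 / ((norm x)\<^sup>2 * L)"
    and "1 / ((norm x)\<^sup>2 * L) \<le> 1 / (norm x ^ 3 * L)"
    and "1 / (norm x ^ 3 * L) \<le> 1 / (norm x ^ 4 * L\<^sup>2)"
proof -
  note b = radial_bounds[OF assms(1,2), folded L_def]
  have r: "norm x > 0" using assms(1) by simp
  have pow: "norm x ^ Suc k * L \<le> norm x ^ k * L" for k
    using b r by (intro mult_right_mono power_decreasing) auto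
  show "1 \<le> 1 / (norm x * L)"
    using b r by (simp add: le_divide_eq)
  show "1 / (norm x * L) \<le> 1 / ((norm x)\<^sup>2 * L)"
    using pow[of 1] b r by (intro divide_left_mono) (auto simp: eval_nat_numeral)
  show "1 / ((norm x)\<^sup>2 * L) \<le> 1 / (norm x ^ 3 * L)"
    using pow[of 2] b r by (intro divide_left_mono) (auto simp: eval_nat_numeral)
  have "norm x ^ 4 * L\<^sup>2 = (norm x ^ 3 * L) * (norm x * L)"
    by (simp add: eval_nat_numeral)
  also have "\<dots> \<le> (norm x ^ 3 * L) * 1"
    using b r by (intro mult_left_mono) auto
  finally show "1 / (norm x ^ 3 * L) \<le> 1 / (norm x ^ 4 * L\<^sup>2)"
    using b r by (intro divide_left_mono) auto
qed

lemma norm_wave_le: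
  assumes "s \<le> - 2" "k \<ge> 1" "cmod c \<le> C"
  shows "norm (wave c k s) \<le> C / - s"
proof -
  have "norm (wave c k s) = cmod c / (- s) ^ k"
    using assms(1) by (intro norm_wave) simp
  also have "\<dots> \<le> C / (- s) ^ k"
    using assms by (intro divide_right_mono) auto
  also have "\<dots> \<le> C / (- s)"
    using assms power_increasing[of 1 k "- s"] order_trans[OF norm_ge_zero assms(3)]
    by (intro divide_left_mono mult_pos_pos zero_less_power) auto
  finally show ?thesis .
qed

lemma profile_bounds:
  fixes x :: "real^4"
  assumes "x \<noteq> 0" "norm x \<le> exp (- 2)"
  defines "L \<equiv> - ln (norm x)"
  shows "norm (wave 1 0 (ln (norm x))) \<le> 5 / ((norm x)\<^sup>2 * L)"
    and "norm (radial_grad (wave (- \<i>) 1) i x) \<le> 5 / ((norm x)\<^sup>2 * L)"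
    and "norm (radial_hess (wave (- \<i>) 1) (wave (-1 - \<i>) 2) i j x) \<le> 5 / ((norm x)\<^sup>2 * L)"
    and "norm (lap_profile (ln (norm x))) \<le> 5 / ((norm x)\<^sup>2 * L)"
    and "norm (radial_grad lap_profile' i x) \<le> 8 / (norm x ^ 3 * L)"
    and "norm (bilap x) \<le> 18 / (norm x ^ 4 * L\<^sup>2)"
proof -
  note b = radial_bounds[OF assms(1,2), folded L_def]
  note w = weight_le[OF assms(1,2), folded L_def]
  have r: "norm x > 0" using assms(1) by simp
  have s: "ln (norm x) \<le> - 2" "ln (norm x) < 0" "ln (norm x) = - L" using b by (auto simp: L_def)
  have n1: "norm (wave (- \<i>) 1 (ln (norm x))) \<le> 1 / L"
    using norm_wave_le[OF s(1), of 1 "- \<i>" 1] by (simp add: s(3))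
  have n2: "norm (wave (-1 - \<i>) 2 (ln (norm x))) \<le> 2 / L"
    using norm_wave_le[OF s(1) _ cmod_coeffs(1), of 2] by (simp add: s(3))
  have n3: "norm (wave (-3 - \<i>) 3 (ln (norm x))) \<le> 4 / L"
    using norm_wave_le[OF s(1) _ cmod_coeffs(2), of 3] by (simp add: s(3))
  show "norm (wave 1 0 (ln (norm x))) \<le> 5 / ((norm x)\<^sup>2 * L)"
    using w(1,2) s(2) by (simp add: norm_wave)
  have "norm (radial_grad (wave (- \<i>) 1) i x) \<le> 1 / L / norm x"
    by (rule order_trans[OF norm_radial_grad_le], rule divide_right_mono[OF n1]) simp
  then show "norm (radial_grad (wave (- \<i>) 1) i x) \<le> 5 / ((norm x)\<^sup>2 * L)"
    using w(1,2) by (simp add: mult.commute)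
  have "norm (radial_hess (wave (- \<i>) 1) (wave (-1 - \<i>) 2) i j x) \<le> (5 / L) / (norm x)\<^sup>2"
    by (rule order_trans[OF norm_radial_hess_le], rule divide_right_mono) (use n1 n2 in auto)
  then show "norm (radial_hess (wave (- \<i>) 1) (wave (-1 - \<i>) 2) i j x) \<le> 5 / ((norm x)\<^sup>2 * L)"
    by (simp add: mult.commute)
  have ex: "exp (- 2 * ln (norm x)) = inverse ((norm x)\<^sup>2)"
    using exp_m2_ln[OF r] by simp
  have "norm (wave (-1 - \<i>) 2 (ln (norm x)) + 2 *\<^sub>R wave (- \<i>) 1 (ln (norm x))) \<le> 2 / L + 2 * (1 / L)"
    using n1 n2 by (intro norm_triangle_le add_mono) auto
  then have "norm (lap_profile (ln (norm x))) \<le> inverse ((norm x)\<^sup>2) * (4 / L)"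
    unfolding lap_profile_def ex norm_scaleR by (intro mult_mono) auto
  also have "\<dots> \<le> 5 / ((norm x)\<^sup>2 * L)"
    using b r by (simp add: field_simps)
  finally show "norm (lap_profile (ln (norm x))) \<le> 5 / ((norm x)\<^sup>2 * L)" .
  have "norm (wave (-3 - \<i>) 3 (ln (norm x)) - 4 *\<^sub>R wave (- \<i>) 1 (ln (norm x))) \<le> 4 / L + 4 * (1 / L)"
    using n1 n3 by (intro order_trans[OF norm_triangle_ineq4] add_mono) auto
  then have "norm (lap_profile' (ln (norm x))) \<le> inverse ((norm x)\<^sup>2) * (8 / L)"
    unfolding lap_profile'_def ex norm_scaleR by (intro mult_mono) auto
  then have "norm (radial_grad lap_profile' i x) \<le> inverse ((norm x)\<^sup>2) * (8 / L) / norm x"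
    by (intro order_trans[OF norm_radial_grad_le] divide_right_mono) auto
  also have "\<dots> = 8 / (norm x ^ 3 * L)"
    using r by (simp add: field_simps eval_nat_numeral)
  finally show "norm (radial_grad lap_profile' i x) \<le> 8 / (norm x ^ 3 * L)" .
  have n4: "norm (wave (-10) 4 (ln (norm x))) \<le> 10 / L\<^sup>2"
  proof -
    have "norm (wave (-10) 4 (ln (norm x))) = 10 / L ^ 4"
      using s by (simp add: norm_wave)
    also have "\<dots> \<le> 10 / L\<^sup>2"
      using b by (intro divide_left_mono power_increasing) auto
    finally show ?thesis .
  qed
  have n2': "norm (wave (-1 - \<i>) 2 (ln (norm x))) \<le> 2 / L\<^sup>2"
    using cmod_coeffs(1) s by (simp add: norm_wave divide_right_mono)
  have "norm (wave (-10) 4 (ln (norm x)) - 4 *\<^sub>R wave (-1 - \<i>) 2 (ln (norm x))) \<le> 10 / L\<^sup>2 + 4 * (2 / L\<^sup>2)"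
    using n4 n2' by (intro order_trans[OF norm_triangle_ineq4] add_mono) auto
  then have "norm (bilap x) \<le> inverse (norm x ^ 4) * (18 / L\<^sup>2)"
    unfolding bilap_def norm_scaleR by (intro mult_mono) auto
  then show "norm (bilap x) \<le> 18 / (norm x ^ 4 * L\<^sup>2)"
    by (simp add: divide_inverse mult_ac)
qed

lemma integrable_weight:
  "integrable (lebesgue_on small_ball) (\<lambda>x. 1 / (norm x ^ 4 * (- ln (norm x))\<^sup>2))"
  using integrable_log_weight[of 2, where 'a = "real^4"] by simp

lemma L2_on_subcritical:
  fixes f :: "real^4 \<Rightarrow> real^2"
  assumes f: "f \<in> borel_measurable (lebesgue_on small_ball)"
    and bound: "\<And>x. x \<noteq> 0 \<Longrightarrow> norm x \<le> exp (- 2) \<Longrightarrow> norm (f x) \<le> C / ((norm x)\<^sup>2 * - ln (norm x))"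
  shows "L2_on small_ball f"
  unfolding L2_on_def
proof
  show "integrable (lebesgue_on small_ball) (\<lambda>x. (norm (f x))\<^sup>2)"
  proof (rule integrable_dominated_off_0[OF _ _ integrable_weight])
    show "(\<lambda>x. (norm (f x))\<^sup>2) \<in> borel_measurable (lebesgue_on small_ball)"
      using f by measurable
    fix x :: "real^4" assume "x \<in> small_ball" "x \<noteq> 0"
    then have "(norm (f x))\<^sup>2 \<le> (C / ((norm x)\<^sup>2 * - ln (norm x)))\<^sup>2"
      using bound[of x] by (intro power_mono) auto
    also have "\<dots> = C\<^sup>2 * (1 / (norm x ^ 4 * (- ln (norm x))\<^sup>2))"
      by (simp add: power_divide power_mult_distrib power_mult[symmetric])
    finally show "norm ((norm (f x))\<^sup>2) \<le> C\<^sup>2 * (1 / (norm x ^ 4 * (- ln (norm x))\<^sup>2))"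
      by simp
  qed simp
qed (rule f)

lemma integrable_critical:
  fixes f :: "real^4 \<Rightarrow> real^2"
  assumes f: "f \<in> borel_measurable (lebesgue_on small_ball)"
    and bound: "\<And>x. x \<noteq> 0 \<Longrightarrow> norm x \<le> exp (- 2) \<Longrightarrow> norm (f x) \<le> C / (norm x ^ 3 * - ln (norm x))"
    and "C \<ge> 0"
  shows "integrable (lebesgue_on small_ball) f"
proof (rule integrable_dominated_off_0[OF _ f integrable_weight])
  fix x :: "real^4" assume x: "x \<in> small_ball" "x \<noteq> 0"
  then have "norm (f x) \<le> C * (1 / (norm x ^ 3 * - ln (norm x)))"
    using bound[of x] by auto
  also have "\<dots> \<le> C * (1 / (norm x ^ 4 * (- ln (norm x))\<^sup>2))"
    using weight_le(4)[of x] x \<open>C \<ge> 0\<close> by (intro mult_left_mono) auto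
  finally show "norm (f x) \<le> C * (1 / (norm x ^ 4 * (- ln (norm x))\<^sup>2))" .
qed simp

lemma decay_critical:
  fixes f :: "real^4 \<Rightarrow> real^2"
  assumes bound: "\<And>x. x \<noteq> 0 \<Longrightarrow> norm x \<le> exp (- 2) \<Longrightarrow> norm (f x) \<le> C / (norm x ^ 3 * - ln (norm x))"
  shows "((\<lambda>x. norm x ^ (CARD(4) - 1) *\<^sub>R f x) \<longlongrightarrow> 0) (at 0)"
proof (rule Lim_null_comparison)
  have "eventually (\<lambda>x::real^4. x \<in> ball 0 (exp (- 2)) - {0}) (at 0)"
    by (auto simp: eventually_at_topological intro!: exI[of _ "ball 0 (exp (- 2))"])
  then show "\<forall>\<^sub>F x in at 0. norm (norm x ^ (CARD(4) - 1) *\<^sub>R f x) \<le> C / - ln (norm x)"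
  proof eventually_elim
    case (elim x)
    then have "norm x ^ 3 * norm (f x) \<le> norm x ^ 3 * (C / (norm x ^ 3 * - ln (norm x)))"
      by (intro mult_left_mono bound) auto
    also have "\<dots> = C / - ln (norm x)"
      using elim by simp
    finally show ?case by simp
  qed
  have "filterlim (\<lambda>x::real^4. norm x) (at_right 0) (at 0)"
    by (auto simp: filterlim_at eventually_at_filter intro!: tendsto_norm_zero)
  then have "filterlim (\<lambda>x::real^4. ln (norm x)) at_bot (at 0)"
    by (rule filterlim_compose[OF ln_at_0])
  then have "filterlim (\<lambda>x::real^4. - ln (norm x)) at_infinity (at 0)"
    by (intro filterlim_at_top_imp_at_infinity) (simp add: filterlim_uminus_at_top)
  then show "((\<lambda>x::real^4. C / - ln (norm x)) \<longlongrightarrow> 0) (at 0)"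
    by (rule tendsto_divide_0[OF tendsto_const])
qed

section \<open>Oscillation at the origin\<close>

text \<open>Along the points \<open>y n\<close> with \<open>ln (- ln |y n|) = a + 2 \<pi> n\<close>, which tend to 0, the second
  component is constantly \<open>cos a\<close>. The phases \<open>\<pi>\<close> and \<open>2 \<pi>\<close> give different limits.\<close>

lemma no_limit_at_0:
  fixes u :: "real^4 \<Rightarrow> real^2"
  assumes u2: "\<And>x. x \<in> small_ball \<Longrightarrow> x \<noteq> 0 \<Longrightarrow> u x $ 2 = cos (ln (- ln (norm x)))"
  shows "\<not> continuous (at 0 within small_ball) (u(0 := v))"
proof
  assume "continuous (at 0 within small_ball) (u(0 := v))"
  then have lim: "((u(0 := v)) \<longlongrightarrow> v) (at 0 within small_ball)"
    by (simp add: continuous_within)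
  have "v $ 2 = cos a" if "a \<ge> 1" for a
  proof -
    define \<theta> where "\<theta> n = a + 2 * pi * real n" for n
    define y :: "nat \<Rightarrow> real^4" where "y n = exp (- exp (\<theta> n)) *\<^sub>R axis 1 1" for n
    have ny: "norm (y n) = exp (- exp (\<theta> n))" for n
      by (simp add: y_def norm_axis_1)
    \<comment> \<open>A phase of at least 1 keeps the points in the ball, as \<open>e\<^bsup>\<theta>\<^esup> \<ge> 1 + \<theta> \<ge> 2\<close>.\<close>
    have "\<theta> n \<ge> 1" for n
      using that by (simp add: \<theta>_def add_increasing2)
    then have "exp (\<theta> n) \<ge> 2" for n
      using exp_ge_add_one_self[of "\<theta> n"] by (metis add_mono one_add_one order_trans order_refl add.commute)
    then have y: "y n \<in> small_ball" "y n \<noteq> 0" for n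
      using ny[of n] by auto
    have "filterlim \<theta> at_top sequentially"
      unfolding \<theta>_def
      by (intro filterlim_tendsto_add_at_top[OF tendsto_const] filterlim_tendsto_pos_mult_at_top[OF tendsto_const])
        (auto simp: filterlim_real_sequentially)
    then have "filterlim (\<lambda>n. - exp (\<theta> n)) at_bot sequentially"
      by (intro filterlim_uminus_at_bot_at_top[THEN filterlim_compose] filterlim_compose[OF exp_at_top])
    then have "(\<lambda>n. norm (y n)) \<longlonglongrightarrow> 0"
      unfolding ny by (rule filterlim_compose[OF exp_at_bot])
    then have "filterlim y (at 0 within small_ball) sequentially"
      using y by (auto simp: filterlim_at tendsto_norm_zero_iff)
    from tendsto_vec_nth[OF filterlim_compose[OF lim this], of 2]
    have "(\<lambda>n. u (y n) $ 2) \<longlonglongrightarrow> v $ 2"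
      using y(2) by simp
    moreover have "u (y n) $ 2 = cos a" for n
    proof -
      have "\<theta> n = a + 2 * real n * pi" by (simp add: \<theta>_def)
      then have "cos (\<theta> n) = cos a"
        using cos_2npi[of n] sin_2npi[of n] by (simp only: cos_add)
      then show ?thesis
        using u2[OF y, of n] by (simp add: ny)
    qed
    ultimately show ?thesis
      by (simp add: LIMSEQ_const_iff)
  qed
  from this[of pi] this[of "2 * pi"] show False
    using pi_gt3 by simp
qed

section \<open>A bounded weak solution that is discontinuous at the origin\<close>

theorem theorem1p4:
  fixes \<Omega> :: "(real^4) set" and u :: "real^4 \<Rightarrow> real^2"
  assumes "\<Omega> = {x. norm x \<le> exp (- 2)}"
    and "\<And>x. x \<in> \<Omega> \<Longrightarrow> x \<noteq> 0 \<Longrightarrow> u x $ 1 = sin (ln (ln (inverse (norm x))))"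
    and "\<And>x. x \<in> \<Omega> \<Longrightarrow> x \<noteq> 0 \<Longrightarrow> u x $ 2 = cos (ln (ln (inverse (norm x))))"
  shows "(\<forall>x\<in>\<Omega> - {0}. u x \<in> sphere 0 1)
    \<and> W22 \<Omega> u \<and> Linf_on \<Omega> u
    \<and> \<not> (\<exists>v. continuous (at 0 within \<Omega>) (u(0 := v)))
    \<and> W22_weak_solution \<Omega> system_rhs u"
proof -
  have \<Omega>: "\<Omega> = small_ball" using assms(1) by auto
  have \<Omega>_leb: "small_ball \<in> sets lebesgue" by simp
  define S where "S = interior small_ball - {0}"
  have S: "S = ball 0 (exp (- 2)) - {0}" by (simp add: S_def)
  have "open S" unfolding S by (intro open_delete) simp
  have neg: "ln (norm x) < 0" if "x \<noteq> 0" "norm x \<le> exp (- 2)" for x :: "real^4"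
    using radial_bounds(1)[OF that] by simp
  have S_dom: "x \<noteq> 0 \<and> ln (norm x) \<in> {..<0}" if "x \<in> S" for x
    using that neg[of x] by (auto simp: S)
  have S_ball: "x \<noteq> 0" "x \<in> small_ball" "norm x \<le> exp (- 2)" "ln (norm x) < 0" if "x \<in> S" for x
    using that neg[of x] by (auto simp: S)

  define Du :: "4 \<Rightarrow> real^4 \<Rightarrow> real^2" where "Du = radial_grad (wave (- \<i>) 1)"
  define D2u :: "4 \<Rightarrow> 4 \<Rightarrow> real^4 \<Rightarrow> real^2" where "D2u = radial_hess (wave (- \<i>) 1) (wave (-1 - \<i>) 2)"
  \<comment> \<open>\<open>V\<close> is the gradient of the Laplacian, and \<open>F\<close> the right-hand side evaluated on the map.\<close>
  define V :: "4 \<Rightarrow> real^4 \<Rightarrow> real^2" where "V = radial_grad lap_profile'"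
  define lap where "lap x = (\<Sum>i\<in>UNIV. D2u i i x)" for x
  define F where "F x = system_rhs (u x) (\<Sum>i\<in>UNIV. (norm (Du i x))\<^sup>2) (lap x)" for x

  have u: "u x = wave 1 0 (ln (norm x))" if "x \<in> small_ball" "x \<noteq> 0" for x
  proof -
    have "ln (norm x) < 0" "ln (inverse (norm x)) = - ln (norm x)"
      using that neg[of x] by (simp_all add: ln_inverse)
    then show ?thesis
      using assms(2,3)[of x] that by (simp add: \<Omega> vec_eq_iff forall_2 wave_nth)
  qed
  have lap: "lap x = lap_profile (ln (norm x))" if "x \<noteq> 0" for x
    using lap_wave_eq[OF that] by (simp add: lap_def D2u_def)
  have F: "F x = bilap x" if "x \<in> small_ball" "x \<noteq> 0" for x
    using system_rhs_wave[OF that(2) neg] that by (simp add: F_def u lap_def Du_def D2u_def)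
  have V_lap: "(\<Sum>i\<in>UNIV. partial_deriv i (V i) x) = F x" if "x \<in> S" for x
  proof -
    have "partial_deriv i (V i) x = radial_hess lap_profile' lap_profile'' i i x" for i
      unfolding V_def
      by (rule partial_deriv_radial_grad[where F'' = lap_profile'']) (use S_ball[OF that] has_vector_derivative_lap_profile in auto)
    then show ?thesis
      using lap_lap_profile_eq[of x] F[of x] S_ball[OF that] by simp
  qed

  have meas_u: "u \<in> borel_measurable (lebesgue_on small_ball)"
    by (rule borel_measurable_off_0[where g = "\<lambda>x. wave 1 0 (ln (norm x))"]) (use u in auto)
  have meas_F: "F \<in> borel_measurable (lebesgue_on small_ball)"
    by (rule borel_measurable_off_0[where g = bilap]) (use F in auto)
  have meas: "Du i \<in> borel_measurable (lebesgue_on small_ball)" "D2u i j \<in> borel_measurable (lebesgue_on small_ball)"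
    "V i \<in> borel_measurable (lebesgue_on small_ball)" "lap \<in> borel_measurable (lebesgue_on small_ball)" for i j
    unfolding lap_def Du_def D2u_def V_def
    by (rule borel_measurable_off_0; measurable)+

  have bounds: "norm (u x) \<le> 5 / ((norm x)\<^sup>2 * - ln (norm x))"
    "norm (Du i x) \<le> 5 / ((norm x)\<^sup>2 * - ln (norm x))"
    "norm (D2u i j x) \<le> 5 / ((norm x)\<^sup>2 * - ln (norm x))"
    "norm (lap x) \<le> 5 / ((norm x)\<^sup>2 * - ln (norm x))"
    "norm (V i x) \<le> 8 / (norm x ^ 3 * - ln (norm x))" if "x \<noteq> 0" "norm x \<le> exp (- 2)" for i j x
    using profile_bounds[OF that] that by (simp_all add: u lap Du_def D2u_def V_def)
  \<comment> \<open>Every bound by the square integrable weight is also one by the weight of decay \<open>o(|x|\<^bsup>-3\<^esup>)\<close>.\<close>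
  have up: "norm y \<le> 5 / (norm x ^ 3 * - ln (norm x))"
    if "x \<noteq> 0" "norm x \<le> exp (- 2)" "norm y \<le> 5 / ((norm x)\<^sup>2 * - ln (norm x))" for x :: "real^4" and y :: "real^2"
    using that(3) weight_le(3)[OF that(1,2)] by simp
  note cbounds = up[OF _ _ bounds(1)] up[OF _ _ bounds(2)] up[OF _ _ bounds(3)] up[OF _ _ bounds(4)]
  have int: "integrable (lebesgue_on small_ball) u" "integrable (lebesgue_on small_ball) (Du i)"
    "integrable (lebesgue_on small_ball) (D2u i j)" "integrable (lebesgue_on small_ball) lap"
    "integrable (lebesgue_on small_ball) (V i)" for i j
    by (rule integrable_critical[OF meas_u cbounds(1)] integrable_critical[OF meas(1) cbounds(2)]
        integrable_critical[OF meas(2) cbounds(3)] integrable_critical[OF meas(4) cbounds(4)]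
        integrable_critical[OF meas(3) bounds(5)]; simp)+
  have int_F: "integrable (lebesgue_on small_ball) F"
  proof (rule integrable_dominated_off_0[OF \<Omega>_leb meas_F integrable_weight])
    fix x assume "x \<in> small_ball" "x \<noteq> 0"
    then show "norm (F x) \<le> 18 * (1 / (norm x ^ 4 * (- ln (norm x))\<^sup>2))"
      using profile_bounds(6)[of x] F[of x] by simp
  qed

  have diff_u: "u differentiable (at x)" "partial_deriv i u x = Du i x" if "x \<in> S" for i x
  proof -
    have d: "(wave 1 0 has_vector_derivative wave (- \<i>) 1 (ln (norm x))) (at (ln (norm x)))"
      by (rule has_vector_derivative_wave_iterates(1)[OF S_ball(4)[OF that]])
    have cong: "u y = wave 1 0 (ln (norm y))" if "y \<in> S" for y
      using u S_ball[OF that] by simp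
    have "(u has_derivative (\<lambda>v. ((x \<bullet> v) / (norm x)\<^sup>2) *\<^sub>R wave (- \<i>) 1 (ln (norm x)))) (at x)"
      by (rule has_derivative_transform_within_open[OF
            has_derivative_radial[of x "wave 1 0", OF S_ball(1)[OF that] d] \<open>open S\<close> that])
        (simp add: cong)
    then show "u differentiable (at x)"
      by (auto simp: differentiable_def)
    have "partial_deriv i u x = partial_deriv i (\<lambda>x. wave 1 0 (ln (norm x))) x"
      by (rule partial_deriv_cong_open[OF \<open>open S\<close> that cong])
    also have "\<dots> = Du i x"
      unfolding Du_def by (rule partial_deriv_radial[of x "wave 1 0" "wave (- \<i>) 1", OF S_ball(1)[OF that] d])
    finally show "partial_deriv i u x = Du i x" .
  qed
  have diff_Du: "Du i differentiable (at x)" "partial_deriv j (Du i) x = D2u i j x" if "x \<in> S" for i j x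
    unfolding Du_def D2u_def differentiable_def
    by (rule exI has_derivative_radial_grad[where F'' = "wave (-1 - \<i>) 2"]
        partial_deriv_radial_grad[where F'' = "wave (-1 - \<i>) 2"];
        use S_ball[OF that] has_vector_derivative_wave_iterates(2) in simp)+
  have diff_lap: "lap differentiable (at x)" "partial_deriv i lap x = V i x" if "x \<in> S" for i x
  proof -
    have d: "(lap_profile has_vector_derivative lap_profile' (ln (norm x))) (at (ln (norm x)))"
      by (rule has_vector_derivative_lap_profile(1)[OF S_ball(4)[OF that]])
    have cong: "lap y = lap_profile (ln (norm y))" if "y \<in> S" for y
      using lap S_ball[OF that] by simp
    have "(lap has_derivative (\<lambda>v. ((x \<bullet> v) / (norm x)\<^sup>2) *\<^sub>R lap_profile' (ln (norm x)))) (at x)"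
      by (rule has_derivative_transform_within_open[OF
            has_derivative_radial[of x "lap_profile", OF S_ball(1)[OF that] d] \<open>open S\<close> that])
        (simp add: cong)
    then show "lap differentiable (at x)"
      by (auto simp: differentiable_def)
    have "partial_deriv i lap x = partial_deriv i (\<lambda>x. lap_profile (ln (norm x))) x"
      by (rule partial_deriv_cong_open[OF \<open>open S\<close> that cong])
    also have "\<dots> = V i x"
      unfolding V_def by (rule partial_deriv_radial[of x lap_profile lap_profile', OF S_ball(1)[OF that] d])
    finally show "partial_deriv i lap x = V i x" .
  qed
  have diff_V: "V i differentiable (at x)" "partial_deriv j (V i) x = radial_hess lap_profile' lap_profile'' i j x"
    if "x \<in> S" for i j x
    unfolding V_def differentiable_def
    by (rule exI has_derivative_radial_grad[where F'' = lap_profile'']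
        partial_deriv_radial_grad[where F'' = lap_profile''];
        use S_ball[OF that] has_vector_derivative_lap_profile in simp)+
  have cont: "continuous_on S (Du i)" "continuous_on S (D2u i j)" for i j
    unfolding Du_def D2u_def
    by (rule continuous_on_radial_grad[OF continuous_on_wave S_dom], assumption)
      (rule continuous_on_radial_hess[OF continuous_on_wave continuous_on_wave S_dom])
  have cont_V: "continuous_on S (partial_deriv i (V i))" for i
    using continuous_on_radial_hess[OF continuous_on_profiles S_dom, of S i i]
    by (subst continuous_on_cong[OF refl diff_V(2)]) auto

  have derivs: "W22_derivs small_ball u Du D2u"
    unfolding W22_derivs_def
  proof (intro conjI allI)
    fix i j
    show "L2_on small_ball u" by (rule L2_on_subcritical[OF meas_u bounds(1)])
    show "L2_on small_ball (Du i)" by (rule L2_on_subcritical[OF meas(1) bounds(2)])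
    show "L2_on small_ball (D2u i j)" by (rule L2_on_subcritical[OF meas(2) bounds(3)])
    show "weak_partial small_ball i u (Du i)"
      by (rule weak_partial_punctured[OF \<Omega>_leb diff_u[unfolded S_def] cont(1)[unfolded S_def] int(1,2)
            decay_critical[OF cbounds(1)]])
    show "weak_partial small_ball j (Du i) (D2u i j)"
      by (rule weak_partial_punctured[OF \<Omega>_leb diff_Du[unfolded S_def] cont(2)[unfolded S_def] int(2,3)
            decay_critical[OF cbounds(2)]])
  qed
  moreover have "integral\<^sup>L (lebesgue_on small_ball) (\<lambda>x. lap x \<bullet> laplacian \<phi> x)
      = integral\<^sup>L (lebesgue_on small_ball) (\<lambda>x. F x \<bullet> \<phi> x)" if "test_function small_ball \<phi>" for \<phi>
    by (rule weak_bilaplacian_punctured[OF \<Omega>_leb that diff_lap[unfolded S_def] diff_V(1)[unfolded S_def]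
          cont_V[unfolded S_def] V_lap[unfolded S_def, symmetric] int(4,5) int_F
          decay_critical[OF cbounds(4)] decay_critical[OF bounds(5)]])
  ultimately have "W22_weak_solution small_ball system_rhs u"
    unfolding W22_weak_solution_def Let_def
    using int_F by (intro exI[of _ Du] exI[of _ D2u]) (simp add: F_def[abs_def] lap_def)
  moreover have unit: "norm (u x) = 1" if "x \<in> small_ball" "x \<noteq> 0" for x
    using that neg[of x] by (simp add: u norm_wave)
  have "AE x in lebesgue_on small_ball. norm (u x) \<le> 1"
    using AE_lebesgue_on_nonzero[OF \<Omega>_leb] AE_space
    by eventually_elim (use unit in \<open>simp add: space_restrict_space\<close>)
  then have "Linf_on small_ball u"
    using meas_u by (auto simp: Linf_on_def)
  moreover have "\<not> continuous (at 0 within small_ball) (u(0 := v))" for v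
    by (rule no_limit_at_0) (use assms(3) in \<open>auto simp: \<Omega> ln_inverse\<close>)
  moreover have "W22 small_ball u"
    using derivs unfolding W22_def by blast
  ultimately show ?thesis
    using unit by (simp add: \<Omega> del: mem_cball)
qed

end
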